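(* For all $x,y,x',y'\in M$, $$\langle\langle x,y\rangle\rangle=\langle\langle x',y'\rangle\rangle \iff x=x' \text{ and } y=y'.$$
   Context: Work in ZFA, i.e. ZF with a set $A$ of atoms. Fix a preorder $\preccurlyeq$ on $A$ with no minimal elements: for every $a\in A$ there is $b\in A$ with $b\preccurlyeq a$ and $a\not\preccurlyeq b$. For $a\in A$ let $pr(a)=\{b\in A:b\preccurlyeq a\}$. Define the magmatic hierarchy: $M_1$ is the set of nonempty subsets $x\subseteq A$ that are downward closed ($a\in x$ and $b\preccurlyeq a$ imply $b\in x$); for $\alpha\geq 1$, $M_{\alpha+1}$ is the set of nonempty $x\subseteq M_\alpha$ such that for every $y\in x$, every $z\in M_\alpha$ with $z\subseteq y$ belongs to $x$; $M_\lambda=\bigcup_{1\leq\beta<\lambda}M_\beta$ for limit $\lambda$; $M=\bigcup_{\alpha\geq1}M_\alpha$. For $x\in M$ let $pr(x)=\{y\in M:y\subseteq x\}$, and $pr^2=pr\circ pr$. Fix two atoms $a_0,a_1\in A$ incomparable under $\preccurlyeq$ ($a_0\not\preccurlyeq a_1$ and $a_1\not\preccurlyeq a_0$). For $x,y\in M$ the magmatic pair is $\langle\langle x,y\rangle\rangle:=pr(pr^2(x)\cup pr^2(a_0))\cup pr(pr^2(y)\cup pr^2(a_1))$. *)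

theory Defs
  imports Main
begin

text \<open>
  Set theory with atoms, ZFA, is rendered as the class of all its first-order models: the type is
  the universe of the model. Separation and Replacement range only over first-order formulas with
  parameters, so that no second-order comprehension is assumed of the model. Formulas use
  de Bruijn indices; the constants for the empty set and for the set of atoms may enter a formula
  as parameters and therefore need no syntax of their own.
\<close>

datatype fm = Member nat nat | Equal nat nat | Neg fm | And fm fm | Exists fm

primrec sat :: "('v \<Rightarrow> 'v \<Rightarrow> bool) \<Rightarrow> (nat \<Rightarrow> 'v) \<Rightarrow> fm \<Rightarrow> bool" where
  "sat E e (Member i j) \<longleftrightarrow> E (e i) (e j)"
| "sat E e (Equal i j) \<longleftrightarrow> e i = e j"
| "sat E e (Neg p) \<longleftrightarrow> \<not> sat E e p"
| "sat E e (And p q) \<longleftrightarrow> sat E e p \<and> sat E e q"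
| "sat E e (Exists p) \<longleftrightarrow> (\<exists>x. sat E (case_nat x e) p)"

class zfa =
  fixes mem :: "'a \<Rightarrow> 'a \<Rightarrow> bool"  (infix \<open>\<^bold>\<in>\<close> 50)
    and nul :: 'a
    and atoms :: 'a
  assumes empty_set: "\<not> x \<^bold>\<in> nul"
    and atoms: "z \<^bold>\<in> atoms \<longleftrightarrow> z \<noteq> nul \<and> (\<nexists>x. x \<^bold>\<in> z)"
    and extensionality:
      "\<not> x \<^bold>\<in> atoms \<Longrightarrow> \<not> y \<^bold>\<in> atoms \<Longrightarrow> (\<forall>z. z \<^bold>\<in> x \<longleftrightarrow> z \<^bold>\<in> y) \<Longrightarrow> x = y"
    and foundation: "\<exists>x. x \<^bold>\<in> s \<Longrightarrow> \<exists>x. x \<^bold>\<in> s \<and> \<not> (\<exists>z. z \<^bold>\<in> x \<and> z \<^bold>\<in> s)"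
    and pairing: "\<exists>p. \<forall>z. z \<^bold>\<in> p \<longleftrightarrow> z = x \<or> z = y"
    and union: "\<exists>v. \<forall>z. z \<^bold>\<in> v \<longleftrightarrow> (\<exists>y. z \<^bold>\<in> y \<and> y \<^bold>\<in> u)"
    and powerset:
      "\<exists>v. \<forall>y. y \<^bold>\<in> v \<longleftrightarrow> \<not> y \<^bold>\<in> atoms \<and> (\<forall>z. z \<^bold>\<in> y \<longrightarrow> z \<^bold>\<in> u)"
    and infinity:
      "\<exists>s. nul \<^bold>\<in> s \<and>
         (\<forall>x. x \<^bold>\<in> s \<longrightarrow> (\<exists>y. y \<^bold>\<in> s \<and> (\<forall>z. z \<^bold>\<in> y \<longleftrightarrow> z \<^bold>\<in> x \<or> z = x)))"
    and separation:
      "\<exists>v. \<forall>x. x \<^bold>\<in> v \<longleftrightarrow> x \<^bold>\<in> u \<and> sat (\<^bold>\<in>) (case_nat x e) p"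
    and replacement:
      "(\<And>x y z. x \<^bold>\<in> u \<Longrightarrow> sat (\<^bold>\<in>) (case_nat x (case_nat y e)) p \<Longrightarrow>
          sat (\<^bold>\<in>) (case_nat x (case_nat z e)) p \<Longrightarrow> y = z) \<Longrightarrow>
       \<exists>v. \<forall>y. y \<^bold>\<in> v \<longleftrightarrow> (\<exists>x. x \<^bold>\<in> u \<and> sat (\<^bold>\<in>) (case_nat x (case_nat y e)) p)"

definition is_set :: "'v::zfa \<Rightarrow> bool" where
  "is_set x \<longleftrightarrow> \<not> x \<^bold>\<in> atoms"

definition subset_of :: "'v::zfa \<Rightarrow> 'v \<Rightarrow> bool"  (infix \<open>\<^bold>\<subseteq>\<close> 50) where
  "x \<^bold>\<subseteq> y \<longleftrightarrow> is_set x \<and> is_set y \<and> (\<forall>z. z \<^bold>\<in> x \<longrightarrow> z \<^bold>\<in> y)"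

text \<open>The set of the model whose elements are those satisfying \<open>P\<close>, when there is one.\<close>

definition the_set :: "('v::zfa \<Rightarrow> bool) \<Rightarrow> 'v" where
  "the_set P = (THE v. is_set v \<and> (\<forall>z. z \<^bold>\<in> v \<longleftrightarrow> P z))"

definition upair :: "'v::zfa \<Rightarrow> 'v \<Rightarrow> 'v" where
  "upair x y = the_set (\<lambda>z. z = x \<or> z = y)"

definition kpair :: "'v::zfa \<Rightarrow> 'v \<Rightarrow> 'v" where
  "kpair x y = upair (upair x x) (upair x y)"

definition un :: "'v::zfa \<Rightarrow> 'v \<Rightarrow> 'v"  (infixl \<open>\<^bold>\<union>\<close> 65) where
  "x \<^bold>\<union> y = the_set (\<lambda>z. z \<^bold>\<in> x \<or> z \<^bold>\<in> y)"

definition osucc :: "'v::zfa \<Rightarrow> 'v" where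
  "osucc x = the_set (\<lambda>z. z \<^bold>\<in> x \<or> z = x)"

text \<open>Von Neumann ordinals of the model; the elements of an ordinal are required to be sets
  because an atom is vacuously transitive.\<close>

definition transitive_set :: "'v::zfa \<Rightarrow> bool" where
  "transitive_set x \<longleftrightarrow> is_set x \<and> (\<forall>y z. y \<^bold>\<in> x \<longrightarrow> z \<^bold>\<in> y \<longrightarrow> z \<^bold>\<in> x)"

definition ordinal :: "'v::zfa \<Rightarrow> bool" where
  "ordinal \<alpha> \<longleftrightarrow> transitive_set \<alpha> \<and> (\<forall>\<beta>. \<beta> \<^bold>\<in> \<alpha> \<longrightarrow> transitive_set \<beta>)"

definition limit_ordinal :: "'v::zfa \<Rightarrow> bool" where
  "limit_ordinal \<alpha> \<longleftrightarrow> ordinal \<alpha> \<and> \<alpha> \<noteq> nul \<and> (\<forall>\<beta>. \<beta> \<^bold>\<in> \<alpha> \<longrightarrow> osucc \<beta> \<^bold>\<in> \<alpha>)"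

definition atom_le :: "'v::zfa \<Rightarrow> 'v \<Rightarrow> 'v \<Rightarrow> bool" where
  "atom_le R b a \<longleftrightarrow> kpair b a \<^bold>\<in> R"

definition preorder_on_atoms :: "'v::zfa \<Rightarrow> bool" where
  "preorder_on_atoms R \<longleftrightarrow>
     is_set R \<and>
     (\<forall>p. p \<^bold>\<in> R \<longrightarrow> (\<exists>a b. a \<^bold>\<in> atoms \<and> b \<^bold>\<in> atoms \<and> p = kpair a b)) \<and>
     (\<forall>a. a \<^bold>\<in> atoms \<longrightarrow> atom_le R a a) \<and>
     (\<forall>a b c. atom_le R a b \<longrightarrow> atom_le R b c \<longrightarrow> atom_le R a c)"

definition no_minimal_atoms :: "'v::zfa \<Rightarrow> bool" where
  "no_minimal_atoms R \<longleftrightarrow>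
     (\<forall>a. a \<^bold>\<in> atoms \<longrightarrow> (\<exists>b. b \<^bold>\<in> atoms \<and> atom_le R b a \<and> \<not> atom_le R a b))"

definition magma_base :: "'v::zfa \<Rightarrow> 'v" where
  "magma_base R = the_set (\<lambda>x. x \<^bold>\<subseteq> atoms \<and> x \<noteq> nul \<and>
     (\<forall>a b. a \<^bold>\<in> x \<longrightarrow> b \<^bold>\<in> atoms \<longrightarrow> atom_le R b a \<longrightarrow> b \<^bold>\<in> x))"

definition magma_next :: "'v::zfa \<Rightarrow> 'v" where
  "magma_next m = the_set (\<lambda>x. x \<^bold>\<subseteq> m \<and> x \<noteq> nul \<and>
     (\<forall>y z. y \<^bold>\<in> x \<longrightarrow> z \<^bold>\<in> m \<longrightarrow> z \<^bold>\<subseteq> y \<longrightarrow> z \<^bold>\<in> x))"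

definition app :: "'v::zfa \<Rightarrow> 'v \<Rightarrow> 'v" where
  "app f x = (THE y. kpair x y \<^bold>\<in> f)"

text \<open>\<open>magma_seq R \<alpha> f\<close>: inside the model, \<open>f\<close> is the function with domain the ordinals
  \<open>1 \<le> \<beta> \<le> \<alpha>\<close> that obeys the recursion of the magmatic hierarchy.\<close>

definition magma_seq :: "'v::zfa \<Rightarrow> 'v \<Rightarrow> 'v \<Rightarrow> bool" where
  "magma_seq R \<alpha> f \<longleftrightarrow>
     is_set f \<and>
     (\<forall>p. p \<^bold>\<in> f \<longrightarrow> (\<exists>\<beta> m. \<beta> \<^bold>\<in> osucc \<alpha> \<and> \<beta> \<noteq> nul \<and> p = kpair \<beta> m)) \<and>
     (\<forall>\<beta>. \<beta> \<^bold>\<in> osucc \<alpha> \<and> \<beta> \<noteq> nul \<longrightarrow> (\<exists>!m. kpair \<beta> m \<^bold>\<in> f)) \<and>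
     (osucc nul \<^bold>\<in> osucc \<alpha> \<longrightarrow> app f (osucc nul) = magma_base R) \<and>
     (\<forall>\<beta>. \<beta> \<noteq> nul \<and> osucc \<beta> \<^bold>\<in> osucc \<alpha> \<longrightarrow> app f (osucc \<beta>) = magma_next (app f \<beta>)) \<and>
     (\<forall>\<gamma>. limit_ordinal \<gamma> \<and> \<gamma> \<^bold>\<in> osucc \<alpha> \<longrightarrow>
        app f \<gamma> = the_set (\<lambda>x. \<exists>\<beta>. \<beta> \<^bold>\<in> \<gamma> \<and> \<beta> \<noteq> nul \<and> x \<^bold>\<in> app f \<beta>))"

definition magma_level :: "'v::zfa \<Rightarrow> 'v \<Rightarrow> 'v" where
  "magma_level R \<alpha> = app (THE f. magma_seq R \<alpha> f) \<alpha>"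

text \<open>The hierarchy is a proper class of the model, hence a HOL set.\<close>

definition magmas :: "'v::zfa \<Rightarrow> 'v set" where
  "magmas R = {x. \<exists>\<alpha>. ordinal \<alpha> \<and> \<alpha> \<noteq> nul \<and> x \<^bold>\<in> magma_level R \<alpha>}"

definition pr :: "'v::zfa \<Rightarrow> 'v \<Rightarrow> 'v" where
  "pr R x =
     (if x \<^bold>\<in> atoms then the_set (\<lambda>b. b \<^bold>\<in> atoms \<and> atom_le R b x)
      else the_set (\<lambda>y. y \<in> magmas R \<and> y \<^bold>\<subseteq> x))"

definition magma_pair :: "'v::zfa \<Rightarrow> 'v \<Rightarrow> 'v \<Rightarrow> 'v \<Rightarrow> 'v \<Rightarrow> 'v" where
  "magma_pair R a0 a1 x y =
     pr R (pr R (pr R x) \<^bold>\<union> pr R (pr R a0)) \<^bold>\<union> pr R (pr R (pr R y) \<^bold>\<union> pr R (pr R a1))"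

end

theory Submission
  imports Defs
begin

text \<open>
  Write \<open>U(x,a) = pr(pr(x)) \<union> pr(pr(a))\<close>. This union mixes two levels, but it lies in the level
  after any limit level above both, so \<open>U(x,a)\<close> is itself a magma and hence an element of
  \<open>pr(U(x,a))\<close>. Equality of two pairs therefore makes \<open>U(x,a0)\<close> a subset of \<open>U(x',a0)\<close> or of
  \<open>U(y',a1)\<close>. The second is impossible, since \<open>pr(a0)\<close> contains the atom \<open>a0\<close>, which is neither a
  magma nor below \<open>a1\<close>. In the first, \<open>pr(x)\<close> contains no atoms and so lies in \<open>pr(pr(x'))\<close>, which
  gives \<open>x \<subseteq> x'\<close>.

  Separation and Replacement hold only for first-order formulas, so transfinite induction and
  recursion are available only for definable classes; closure properties of definability with
  parameters replace explicit formulas.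
\<close>

section \<open>Definability with parameters\<close>

primrec rename_fm :: "(nat \<Rightarrow> nat) \<Rightarrow> fm \<Rightarrow> fm" where
  "rename_fm f (Member i j) = Member (f i) (f j)"
| "rename_fm f (Equal i j) = Equal (f i) (f j)"
| "rename_fm f (Neg p) = Neg (rename_fm f p)"
| "rename_fm f (And p q) = And (rename_fm f p) (rename_fm f q)"
| "rename_fm f (Exists p) = Exists (rename_fm (case_nat 0 (Suc \<circ> f)) p)"

lemma sat_rename_fm: "sat E e (rename_fm f p) \<longleftrightarrow> sat E (e \<circ> f) p"
proof (induction p arbitrary: e f)
  case (Exists p)
  have "case_nat x e \<circ> case_nat 0 (Suc \<circ> f) = case_nat x (e \<circ> f)" for x
    by (auto simp: fun_eq_iff split: nat.split)
  then show ?case by (simp only: rename_fm.simps sat.simps Exists.IH)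
qed auto

text \<open>The map \<open>h\<close> sends each variable of the formula to a position of the environment or to a
  parameter.\<close>

definition definable :: "((nat \<Rightarrow> 'v::zfa) \<Rightarrow> bool) \<Rightarrow> bool" where
  "definable Q \<longleftrightarrow> (\<exists>p h. \<forall>e. Q e \<longleftrightarrow> sat (\<^bold>\<in>) (case_sum e id \<circ> h) p)"

lemma definableI:
  assumes "\<And>e. Q e \<longleftrightarrow> sat (\<^bold>\<in>) (case_sum e id \<circ> h) p"
  shows "definable Q"
  using assms unfolding definable_def by blast

lemma definable_rename:
  assumes "definable Q"
  shows "definable (\<lambda>e. Q (\<lambda>i. e (f i)))"
proof -
  obtain p h where Q: "\<And>e. Q e \<longleftrightarrow> sat (\<^bold>\<in>) (case_sum e id \<circ> h) p"
    using assms unfolding definable_def by blast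
  have "case_sum (\<lambda>i. e (f i)) id \<circ> h = case_sum e id \<circ> (map_sum f id \<circ> h)" for e :: "nat \<Rightarrow> 'a"
    by (auto simp: fun_eq_iff split: sum.split)
  then show ?thesis by (intro definableI[where h = "map_sum f id \<circ> h"]) (simp add: Q)
qed

lemma definable_mem_var: "definable (\<lambda>e. e i \<^bold>\<in> e j)"
  by (rule definableI[where h = "case_nat (Inl i) (\<lambda>_. Inl j)" and p = "Member 0 1"]) simp

lemma definable_eq_var: "definable (\<lambda>e. e i = e j)"
  by (rule definableI[where h = "case_nat (Inl i) (\<lambda>_. Inl j)" and p = "Equal 0 1"]) simp

lemma definable_eq_const: "definable (\<lambda>e. e i = c)"
  by (rule definableI[where h = "case_nat (Inl i) (\<lambda>_. Inr c)" and p = "Equal 0 1"]) simp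

lemma definable_not:
  assumes "definable P"
  shows "definable (\<lambda>e. \<not> P e)"
  using assms unfolding definable_def by (metis sat.simps(3))

lemma definable_conj:
  assumes "definable P" "definable Q"
  shows "definable (\<lambda>e. P e \<and> Q e)"
proof -
  obtain p h where P: "\<And>e. P e \<longleftrightarrow> sat (\<^bold>\<in>) (case_sum e id \<circ> h) p"
    using assms(1) unfolding definable_def by blast
  obtain q k where Q: "\<And>e. Q e \<longleftrightarrow> sat (\<^bold>\<in>) (case_sum e id \<circ> k) q"
    using assms(2) unfolding definable_def by blast
  let ?m = "\<lambda>i. if even i then h (i div 2) else k (i div 2)"
  have "case_sum e id \<circ> ?m \<circ> (\<lambda>i. 2 * i) = case_sum e id \<circ> h"
    "case_sum e id \<circ> ?m \<circ> (\<lambda>i. Suc (2 * i)) = case_sum e id \<circ> k" for e :: "nat \<Rightarrow> 'a"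
    by (simp_all add: fun_eq_iff)
  then show ?thesis
    by (intro definableI[where h = ?m and
          p = "And (rename_fm (\<lambda>i. 2 * i) p) (rename_fm (\<lambda>i. Suc (2 * i)) q)"])
      (simp add: sat_rename_fm P Q)
qed

lemma definable_ex:
  assumes "definable (\<lambda>e. P (e 0) (\<lambda>i. e (Suc i)))"
  shows "definable (\<lambda>e. \<exists>x. P x e)"
proof -
  obtain p h where P: "\<And>e. P (e 0) (\<lambda>i. e (Suc i)) \<longleftrightarrow> sat (\<^bold>\<in>) (case_sum e id \<circ> h) p"
    using assms unfolding definable_def by blast
  let ?k = "map_sum (\<lambda>j. j - 1) id \<circ> h" and ?f = "\<lambda>i. if h i = Inl 0 then 0 else Suc i"
  have "case_nat x (case_sum e id \<circ> ?k) \<circ> ?f = case_sum (case_nat x e) id \<circ> h" for x e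
    by (auto simp: fun_eq_iff split: sum.split nat.split)
  then have "P x e \<longleftrightarrow> sat (\<^bold>\<in>) (case_nat x (case_sum e id \<circ> ?k)) (rename_fm ?f p)" for x e
    using P[of "case_nat x e"] by (simp add: sat_rename_fm)
  then show ?thesis by (intro definableI[where h = ?k and p = "Exists (rename_fm ?f p)"]) simp
qed

lemma definable_imp:
  assumes "definable P" "definable Q"
  shows "definable (\<lambda>e. P e \<longrightarrow> Q e)"
  using definable_not[OF definable_conj[OF assms(1) definable_not[OF assms(2)]]] by simp

lemma definable_disj:
  assumes "definable P" "definable Q"
  shows "definable (\<lambda>e. P e \<or> Q e)"
  using definable_imp[OF definable_not[OF assms(1)] assms(2)] by (simp add: disj_imp)

lemma definable_iff:
  assumes "definable P" "definable Q"
  shows "definable (\<lambda>e. P e \<longleftrightarrow> Q e)"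
  using definable_conj[OF definable_imp[OF assms] definable_imp[OF assms(2,1)]]
  by (simp add: iff_conv_conj_imp)

lemma definable_all:
  assumes "definable (\<lambda>e. P (e 0) (\<lambda>i. e (Suc i)))"
  shows "definable (\<lambda>e. \<forall>x. P x e)"
  using definable_not[OF definable_ex[of "\<lambda>x e. \<not> P x e", OF definable_not[OF assms]]] by simp

lemma definable_ex1:
  assumes "definable (\<lambda>e. P (e 0) (\<lambda>i. e (Suc i)))"
  shows "definable (\<lambda>e. \<exists>!x. P x e)"
proof -
  have "definable (\<lambda>e. P (e 0) (\<lambda>i. e (Suc (Suc i))))"
    using definable_rename[OF assms, of "case_nat 0 (\<lambda>i. Suc (Suc i))"] by simp
  then show ?thesis
    unfolding Ex1_def
    by (intro definable_ex definable_all definable_conj definable_imp definable_eq_var assms)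
qed

definition definable_term :: "((nat \<Rightarrow> 'v::zfa) \<Rightarrow> 'v) \<Rightarrow> bool" where
  "definable_term F \<longleftrightarrow> definable (\<lambda>e. e 0 = F (\<lambda>i. e (Suc i)))"

lemma definable_term_var: "definable_term (\<lambda>e. e i)"
  unfolding definable_term_def by (rule definable_eq_var)

lemma definable_term_const: "definable_term (\<lambda>e. c)"
  unfolding definable_term_def by (rule definable_eq_const)

lemma definable_term_rename:
  assumes "definable_term F"
  shows "definable_term (\<lambda>e. F (\<lambda>i. e (f i)))"
  using definable_rename[OF assms[unfolded definable_term_def], of "case_nat 0 (\<lambda>i. Suc (f i))"]
  unfolding definable_term_def by simp

lemma definable_subst:
  assumes "definable_term F" "definable (\<lambda>e. P (e 0) (\<lambda>i. e (Suc i)))"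
  shows "definable (\<lambda>e. P (F e) e)"
proof -
  have "definable (\<lambda>e. \<exists>x. x = F e \<and> P x e)"
    using assms unfolding definable_term_def by (intro definable_ex definable_conj)
  then show ?thesis by simp
qed

lemma definable_comp1:
  assumes "definable (\<lambda>e. P (e 0))" "definable_term F"
  shows "definable (\<lambda>e. P (F e))"
  using definable_subst[OF assms(2), of "\<lambda>x e. P x"] assms(1) by simp

lemma definable_comp2:
  assumes "definable (\<lambda>e. P (e 0) (e 1))" "definable_term F" "definable_term G"
  shows "definable (\<lambda>e. P (F e) (G e))"
proof (rule definable_subst[OF assms(2)])
  show "definable (\<lambda>e. P (e 0) (G (\<lambda>i. e (Suc i))))"
  proof (rule definable_subst[OF definable_term_rename[OF assms(3)]])
    show "definable (\<lambda>e. P (e (Suc 0)) (e 0))"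
      using definable_rename[OF assms(1), of "\<lambda>i. if i = 0 then 1 else 0"] by simp
  qed
qed

lemma definable_term_subst:
  assumes "definable_term F" "definable_term (\<lambda>e. H (e 0) (\<lambda>i. e (Suc i)))"
  shows "definable_term (\<lambda>e. H (F e) e)"
proof -
  have "definable (\<lambda>e. e (Suc 0) = H (e 0) (\<lambda>i. e (Suc (Suc i))))"
    using definable_rename[OF assms(2)[unfolded definable_term_def],
        of "case_nat (Suc 0) (case_nat 0 (\<lambda>i. Suc (Suc i)))"] by simp
  then show ?thesis
    unfolding definable_term_def by (rule definable_subst[OF definable_term_rename[OF assms(1)]])
qed

lemma definable_term_comp1:
  assumes "definable_term (\<lambda>e. H (e 0))" "definable_term F"
  shows "definable_term (\<lambda>e. H (F e))"
  using definable_term_subst[OF assms(2), of "\<lambda>x e. H x"] assms(1) by simp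

lemma definable_term_comp2:
  assumes "definable_term (\<lambda>e. H (e 0) (e 1))" "definable_term F" "definable_term G"
  shows "definable_term (\<lambda>e. H (F e) (G e))"
proof (rule definable_term_subst[OF assms(2)])
  show "definable_term (\<lambda>e. H (e 0) (G (\<lambda>i. e (Suc i))))"
  proof (rule definable_term_subst[OF definable_term_rename[OF assms(3)]])
    show "definable_term (\<lambda>e. H (e (Suc 0)) (e 0))"
      using definable_term_rename[OF assms(1), of "\<lambda>i. if i = 0 then 1 else 0"] by simp
  qed
qed

lemma definable_term_if:
  assumes "definable P" "definable_term F" "definable_term G"
  shows "definable_term (\<lambda>e. if P e then F e else G e)"
proof -
  have "definable (\<lambda>e. P (\<lambda>i. e (Suc i)))" using assms(1) by (rule definable_rename)
  then have "definable (\<lambda>e. P (\<lambda>i. e (Suc i)) \<and> e 0 = F (\<lambda>i. e (Suc i)) \<or>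
      \<not> P (\<lambda>i. e (Suc i)) \<and> e 0 = G (\<lambda>i. e (Suc i)))"
    using assms(2,3) unfolding definable_term_def
    by (intro definable_disj definable_conj definable_not)
  moreover have "v = (if b then x else y) \<longleftrightarrow> b \<and> v = x \<or> \<not> b \<and> v = y" for b and v x y :: 'a
    by simp
  ultimately show ?thesis unfolding definable_term_def by presburger
qed

lemma definable_mem:
  assumes "definable_term F" "definable_term G"
  shows "definable (\<lambda>e. F e \<^bold>\<in> G e)"
  using definable_comp2[where P = "(\<^bold>\<in>)", OF definable_mem_var assms] .

lemma definable_eq:
  assumes "definable_term F" "definable_term G"
  shows "definable (\<lambda>e. F e = G e)"
  using definable_comp2[where P = "(=)", OF definable_eq_var assms] .

named_theorems definable_intros

lemmas [definable_intros] = definable_term_var definable_term_const definable_term_if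
  definable_mem definable_eq definable_not definable_conj definable_disj definable_imp
  definable_iff definable_ex definable_all definable_ex1

lemma definable_is_set [definable_intros]:
  assumes "definable_term F"
  shows "definable (\<lambda>e. is_set (F e))"
  using assms unfolding is_set_def by (intro definable_intros)

lemma definable_subset [definable_intros]:
  assumes "definable_term F" "definable_term G"
  shows "definable (\<lambda>e. F e \<^bold>\<subseteq> G e)"
  by (rule definable_comp2[OF _ assms]) (unfold subset_of_def, intro definable_intros)

section \<open>Set formation\<close>

lemma not_mem_nul [simp]: "\<not> x \<^bold>\<in> nul"
  by (rule empty_set)

lemma is_set_nul [simp]: "is_set nul"
  unfolding is_set_def using atoms by blast

lemma is_setI: "z \<^bold>\<in> x \<Longrightarrow> is_set x"
  unfolding is_set_def using atoms by blast

lemma set_ext: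
  assumes "is_set x" "is_set y" "\<And>z. z \<^bold>\<in> x \<longleftrightarrow> z \<^bold>\<in> y"
  shows "x = y"
  using extensionality assms unfolding is_set_def by blast

lemma nonempty_set:
  assumes "is_set x" "x \<noteq> nul"
  obtains z where "z \<^bold>\<in> x"
  using assms set_ext[OF assms(1) is_set_nul] not_mem_nul by blast

lemma subset_refl: "is_set x \<Longrightarrow> x \<^bold>\<subseteq> x"
  unfolding subset_of_def by blast

lemma subset_trans: "x \<^bold>\<subseteq> y \<Longrightarrow> y \<^bold>\<subseteq> z \<Longrightarrow> x \<^bold>\<subseteq> z"
  unfolding subset_of_def by blast

lemma subset_antisym: "x \<^bold>\<subseteq> y \<Longrightarrow> y \<^bold>\<subseteq> x \<Longrightarrow> x = y"
  unfolding subset_of_def by (blast intro: set_ext)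

lemma subsetD: "x \<^bold>\<subseteq> y \<Longrightarrow> z \<^bold>\<in> x \<Longrightarrow> z \<^bold>\<in> y"
  unfolding subset_of_def by blast

definition small :: "('v::zfa \<Rightarrow> bool) \<Rightarrow> bool" where
  "small P \<longleftrightarrow> (\<exists>v. \<forall>z. z \<^bold>\<in> v \<longleftrightarrow> P z)"

lemma smallE:
  assumes "small P"
  obtains v where "is_set v" "\<And>z. z \<^bold>\<in> v \<longleftrightarrow> P z"
proof -
  obtain v where v: "\<forall>z. z \<^bold>\<in> v \<longleftrightarrow> P z" using assms unfolding small_def by blast
  show thesis
  proof (cases "is_set v")
    case False
    then have "\<not> P z" for z using v is_setI by blast
    then show thesis using that[of nul] by simp
  qed (use v that in blast)
qed

lemma the_set_eq_iff:
  "v = the_set P \<longleftrightarrow>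
     small P \<and> is_set v \<and> (\<forall>z. z \<^bold>\<in> v \<longleftrightarrow> P z) \<or> \<not> small P \<and> v = (THE w. False)"
proof (cases "small P")
  case True
  then obtain w where w: "is_set w" "\<And>z. z \<^bold>\<in> w \<longleftrightarrow> P z" by (rule smallE) blast
  have eq_w: "is_set v \<and> (\<forall>z. z \<^bold>\<in> v \<longleftrightarrow> P z) \<longleftrightarrow> v = w" for v
    using w by (auto intro: set_ext)
  then have "the_set P = w" unfolding the_set_def by simp
  then show ?thesis using True eq_w by simp
next
  case False
  then have no_set: "(is_set w \<and> (\<forall>z. z \<^bold>\<in> w \<longleftrightarrow> P z)) = False" for w unfolding small_def by blast
  have "the_set P = (THE w. False)" unfolding the_set_def no_set ..
  then show ?thesis using False by simp
qed

lemma is_set_the_set: "small P \<Longrightarrow> is_set (the_set P)"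
  and mem_the_set: "small P \<Longrightarrow> z \<^bold>\<in> the_set P \<longleftrightarrow> P z"
  using the_set_eq_iff[of "the_set P" P] by blast+

text \<open>No smallness assumption is needed: the junk value of \<open>the_set\<close> is a single parameter.\<close>

lemma definable_term_the_set [definable_intros]:
  assumes "definable (\<lambda>e. P (e 0) (\<lambda>i. e (Suc i)))"
  shows "definable_term (\<lambda>e. the_set (\<lambda>z. P z e))"
proof -
  have "definable (\<lambda>e. P (e 0) (\<lambda>i. e (Suc (Suc i))))"
    "definable (\<lambda>e. P (e 0) (\<lambda>i. e (Suc (Suc (Suc i)))))"
    using definable_rename[OF assms, of "case_nat 0 (\<lambda>i. Suc (Suc i))"]
      definable_rename[OF assms, of "case_nat 0 (\<lambda>i. Suc (Suc (Suc i)))"] by simp_all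
  then show ?thesis
    unfolding definable_term_def the_set_eq_iff small_def by (intro definable_intros)
qed

lemma small_mem: "small (\<lambda>z. z \<^bold>\<in> u)"
  unfolding small_def by blast

lemma small_upair: "small (\<lambda>z. z = x \<or> z = y)"
  unfolding small_def by (rule pairing)

lemma small_Union:
  assumes "small P"
  shows "small (\<lambda>z. \<exists>y. P y \<and> z \<^bold>\<in> y)"
proof -
  obtain u where "\<And>y. y \<^bold>\<in> u \<longleftrightarrow> P y" using assms by (rule smallE) blast
  then show ?thesis using union[of u] unfolding small_def by (simp add: conj_commute)
qed

lemma small_disj:
  assumes "small P" "small Q"
  shows "small (\<lambda>z. P z \<or> Q z)"
proof -
  obtain u where u: "\<And>z. z \<^bold>\<in> u \<longleftrightarrow> P z" using assms(1) by (rule smallE) blast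
  obtain w where w: "\<And>z. z \<^bold>\<in> w \<longleftrightarrow> Q z" using assms(2) by (rule smallE) blast
  show ?thesis
    using small_Union[OF small_upair[of u w]]
    by (simp add: ex_disj_distrib conj_disj_distribR u w)
qed

lemma small_separation:
  assumes "small Q" "definable (\<lambda>e. P (e 0))"
  shows "small (\<lambda>x. Q x \<and> P x)"
proof -
  obtain u where u: "\<And>x. x \<^bold>\<in> u \<longleftrightarrow> Q x" using assms(1) by (rule smallE) blast
  obtain p h where P: "\<And>e :: nat \<Rightarrow> 'a. P (e 0) \<longleftrightarrow> sat (\<^bold>\<in>) (case_sum e id \<circ> h) p"
    using assms(2) unfolding definable_def by blast
  let ?c = "case_sum (\<lambda>_. undefined) id \<circ> h" and ?f = "\<lambda>i. case h i of Inl _ \<Rightarrow> 0 | Inr _ \<Rightarrow> Suc i"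
  have "case_nat x ?c \<circ> ?f = case_sum (\<lambda>_. x) id \<circ> h" for x
    by (auto simp: fun_eq_iff split: sum.split)
  then have P_iff: "P x \<longleftrightarrow> sat (\<^bold>\<in>) (case_nat x ?c) (rename_fm ?f p)" for x
    using P[of "\<lambda>_. x"] by (simp add: sat_rename_fm)
  show ?thesis unfolding small_def u[symmetric] P_iff by (rule separation)
qed

lemma small_replacement:
  assumes "small Q" "definable (\<lambda>e. P (e 0) (e 1))"
    and functional: "\<And>x y z. Q x \<Longrightarrow> P x y \<Longrightarrow> P x z \<Longrightarrow> y = z"
  shows "small (\<lambda>y. \<exists>x. Q x \<and> P x y)"
proof -
  obtain u where u: "\<And>x. x \<^bold>\<in> u \<longleftrightarrow> Q x" using assms(1) by (rule smallE) blast
  obtain p h where P: "\<And>e :: nat \<Rightarrow> 'a. P (e 0) (e 1) \<longleftrightarrow> sat (\<^bold>\<in>) (case_sum e id \<circ> h) p"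
    using assms(2) unfolding definable_def by blast
  let ?c = "case_sum (\<lambda>_. undefined) id \<circ> h"
    and ?f = "\<lambda>i. case h i of Inl 0 \<Rightarrow> 0 | Inl (Suc _) \<Rightarrow> 1 | Inr _ \<Rightarrow> Suc (Suc i)"
  have "case_nat x (case_nat y ?c) \<circ> ?f = case_sum (case_nat x (\<lambda>_. y)) id \<circ> h" for x y
    by (auto simp: fun_eq_iff split: sum.split nat.split)
  then have P_iff: "P x y \<longleftrightarrow> sat (\<^bold>\<in>) (case_nat x (case_nat y ?c)) (rename_fm ?f p)" for x y
    using P[of "case_nat x (\<lambda>_. y)"] by (simp add: sat_rename_fm)
  show ?thesis
    unfolding small_def u[symmetric] P_iff
    by (rule replacement) (use functional in \<open>unfold u P_iff\<close>)
qed

lemma small_image: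
  assumes "small Q" "definable_term (\<lambda>e. F (e 0))"
  shows "small (\<lambda>y. \<exists>x. Q x \<and> y = F x)"
proof (rule small_replacement[OF assms(1)])
  show "definable (\<lambda>e. e 1 = F (e 0))"
    using definable_term_var assms(2) by (rule definable_eq)
qed simp

lemma small_UN:
  assumes "small Q" "definable_term (\<lambda>e. F (e 0))"
  shows "small (\<lambda>z. \<exists>x. Q x \<and> z \<^bold>\<in> F x)"
proof -
  have "(\<exists>y. (\<exists>x. Q x \<and> y = F x) \<and> z \<^bold>\<in> y) \<longleftrightarrow> (\<exists>x. Q x \<and> z \<^bold>\<in> F x)" for z by blast
  then show ?thesis using small_Union[OF small_image[OF assms]] by simp
qed

lemma small_subset_separation:
  assumes "definable (\<lambda>e. P (e 0))"
  shows "small (\<lambda>x. x \<^bold>\<subseteq> m \<and> P x)"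
proof -
  obtain v where v: "\<And>x. x \<^bold>\<in> v \<longleftrightarrow> \<not> x \<^bold>\<in> atoms \<and> (\<forall>z. z \<^bold>\<in> x \<longrightarrow> z \<^bold>\<in> m)"
    using powerset[of m] by blast
  have "definable (\<lambda>e. e 0 \<^bold>\<subseteq> m \<and> P (e 0))" using assms by (intro definable_intros)
  then have "small (\<lambda>x. x \<^bold>\<in> v \<and> x \<^bold>\<subseteq> m \<and> P x)" by (rule small_separation[OF small_mem])
  moreover have "x \<^bold>\<in> v" if "x \<^bold>\<subseteq> m" for x
    using v that unfolding subset_of_def is_set_def by blast
  ultimately show ?thesis unfolding small_def by metis
qed

lemma mem_upair [simp]: "z \<^bold>\<in> upair x y \<longleftrightarrow> z = x \<or> z = y"
  unfolding upair_def by (rule mem_the_set[OF small_upair])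

lemma is_set_upair [simp]: "is_set (upair x y)"
  unfolding upair_def by (rule is_set_the_set[OF small_upair])

lemma upair_eq_iff: "upair x y = upair u v \<longleftrightarrow> x = u \<and> y = v \<or> x = v \<and> y = u"
proof
  assume "upair x y = upair u v"
  then have "z = x \<or> z = y \<longleftrightarrow> z = u \<or> z = v" for z using mem_upair by metis
  then show "x = u \<and> y = v \<or> x = v \<and> y = u" by metis
qed (auto intro: set_ext)

lemma kpair_eq_iff [simp]: "kpair x y = kpair u v \<longleftrightarrow> x = u \<and> y = v"
  unfolding kpair_def by (auto simp: upair_eq_iff)

lemma mem_un [simp]: "z \<^bold>\<in> x \<^bold>\<union> y \<longleftrightarrow> z \<^bold>\<in> x \<or> z \<^bold>\<in> y"
  unfolding un_def by (rule mem_the_set[OF small_disj[OF small_mem small_mem]])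

lemma is_set_un [simp]: "is_set (x \<^bold>\<union> y)"
  unfolding un_def by (rule is_set_the_set[OF small_disj[OF small_mem small_mem]])

lemma small_osucc: "small (\<lambda>z. z \<^bold>\<in> x \<or> z = x)"
  using small_disj[OF small_mem small_upair[of x x]] by simp

lemma mem_osucc [simp]: "z \<^bold>\<in> osucc x \<longleftrightarrow> z \<^bold>\<in> x \<or> z = x"
  unfolding osucc_def by (rule mem_the_set[OF small_osucc])

lemma is_set_osucc [simp]: "is_set (osucc x)"
  unfolding osucc_def by (rule is_set_the_set[OF small_osucc])

lemma osucc_neq_nul [simp]: "osucc x \<noteq> nul" "nul \<noteq> osucc x"
  using mem_osucc[of x x] not_mem_nul[of x] by metis+

definition Union_set :: "'v::zfa \<Rightarrow> 'v" where
  "Union_set u = the_set (\<lambda>z. \<exists>y. y \<^bold>\<in> u \<and> z \<^bold>\<in> y)"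

lemma mem_Union_set: "z \<^bold>\<in> Union_set u \<longleftrightarrow> (\<exists>y. y \<^bold>\<in> u \<and> z \<^bold>\<in> y)"
  unfolding Union_set_def by (rule mem_the_set[OF small_Union[OF small_mem]])

lemma is_set_Union_set: "is_set (Union_set u)"
  unfolding Union_set_def by (rule is_set_the_set[OF small_Union[OF small_mem]])

lemma definable_term_upair [definable_intros]:
  assumes "definable_term F" "definable_term G"
  shows "definable_term (\<lambda>e. upair (F e) (G e))"
  by (rule definable_term_comp2[OF _ assms]) (unfold upair_def, intro definable_intros)

lemma definable_term_kpair [definable_intros]:
  assumes "definable_term F" "definable_term G"
  shows "definable_term (\<lambda>e. kpair (F e) (G e))"
  using assms unfolding kpair_def by (intro definable_intros)

lemma definable_term_osucc [definable_intros]: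
  assumes "definable_term F"
  shows "definable_term (\<lambda>e. osucc (F e))"
  by (rule definable_term_comp1[OF _ assms]) (unfold osucc_def, intro definable_intros)

lemma definable_term_Union_set [definable_intros]:
  assumes "definable_term F"
  shows "definable_term (\<lambda>e. Union_set (F e))"
  by (rule definable_term_comp1[OF _ assms]) (unfold Union_set_def, intro definable_intros)

definition function_on :: "('v::zfa \<Rightarrow> bool) \<Rightarrow> 'v \<Rightarrow> bool" where
  "function_on A f \<longleftrightarrow> is_set f \<and> (\<forall>p. p \<^bold>\<in> f \<longrightarrow> (\<exists>x y. A x \<and> p = kpair x y)) \<and>
     (\<forall>x. A x \<longrightarrow> (\<exists>!y. kpair x y \<^bold>\<in> f))"

text \<open>Unlike \<open>app\<close>, whose \<open>THE\<close> is unspecified when several values are possible, \<open>value_at\<close>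
  is a definable operation on all arguments.\<close>

definition value_at :: "'v::zfa \<Rightarrow> 'v \<Rightarrow> 'v" where
  "value_at f x = (if \<exists>!y. kpair x y \<^bold>\<in> f then app f x else nul)"

lemma value_at_eqI:
  assumes "\<exists>!y. kpair x y \<^bold>\<in> f" "kpair x v \<^bold>\<in> f"
  shows "value_at f x = v"
  using assms unfolding value_at_def app_def by (simp add: the1_equality)

lemma value_at_eq_iff:
  "v = value_at f x \<longleftrightarrow>
     (\<exists>!y. kpair x y \<^bold>\<in> f) \<and> kpair x v \<^bold>\<in> f \<or> \<not> (\<exists>!y. kpair x y \<^bold>\<in> f) \<and> v = nul"
proof (cases "\<exists>!y. kpair x y \<^bold>\<in> f")
  case True
  then show ?thesis using value_at_eqI by metis
qed (simp add: value_at_def)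

lemma definable_term_value_at [definable_intros]:
  assumes "definable_term F" "definable_term G"
  shows "definable_term (\<lambda>e. value_at (F e) (G e))"
  by (rule definable_term_comp2[OF _ assms])
    (unfold definable_term_def value_at_eq_iff, intro definable_intros)

lemma app_eq_value_at: "function_on A f \<Longrightarrow> A x \<Longrightarrow> app f x = value_at f x"
  unfolding function_on_def value_at_def by simp

lemma function_on_kpair_iff:
  assumes "function_on A f"
  shows "kpair x y \<^bold>\<in> f \<longleftrightarrow> A x \<and> y = value_at f x"
proof -
  have "A x" if "kpair x y \<^bold>\<in> f" using assms that unfolding function_on_def by fastforce
  moreover have "\<exists>!y. kpair x y \<^bold>\<in> f" if "A x" using assms that unfolding function_on_def by blast
  ultimately show ?thesis using value_at_eq_iff[of y f x] by blast
qed

lemma function_on_ext: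
  assumes "function_on A f" "function_on A g" "\<And>x. A x \<Longrightarrow> value_at f x = value_at g x"
  shows "f = g"
proof (rule set_ext)
  show "is_set f" "is_set g" using assms(1,2) unfolding function_on_def by blast+
  have "kpair x y \<^bold>\<in> f \<longleftrightarrow> kpair x y \<^bold>\<in> g" for x y
    using assms by (auto simp: function_on_kpair_iff)
  then show "p \<^bold>\<in> f \<longleftrightarrow> p \<^bold>\<in> g" for p using assms(1,2) unfolding function_on_def by metis
qed

lemma function_on_exists:
  assumes "small A" "definable (\<lambda>e. P (e 0) (e 1))" and ex1: "\<And>x. A x \<Longrightarrow> \<exists>!y. P x y"
  shows "\<exists>f. function_on A f \<and> (\<forall>x. A x \<longrightarrow> P x (value_at f x))"
proof -
  have "small (\<lambda>p. \<exists>x. A x \<and> (\<exists>y. P x y \<and> p = kpair x y))"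
  proof (rule small_replacement[OF assms(1)])
    show "definable (\<lambda>e. \<exists>y. P (e 0) y \<and> e 1 = kpair (e 0) y)"
      by (intro definable_intros definable_comp2[OF assms(2)])
  qed (use ex1 in blast)
  then obtain f where f: "is_set f" "\<And>p. p \<^bold>\<in> f \<longleftrightarrow> (\<exists>x. A x \<and> (\<exists>y. P x y \<and> p = kpair x y))"
    by (rule smallE) blast
  have f_iff: "kpair x y \<^bold>\<in> f \<longleftrightarrow> A x \<and> P x y" for x y unfolding f(2) by auto
  have "function_on A f" unfolding function_on_def f_iff using f ex1 by blast
  moreover have "P x (value_at f x)" if "A x" for x
    using function_on_kpair_iff[OF \<open>function_on A f\<close>] f_iff that by blast
  ultimately show ?thesis by blast
qed

section \<open>Ordinals\<close>

lemma definable_transitive_set [definable_intros]: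
  assumes "definable_term F"
  shows "definable (\<lambda>e. transitive_set (F e))"
  by (rule definable_comp1[OF _ assms]) (unfold transitive_set_def, intro definable_intros)

lemma definable_ordinal [definable_intros]:
  assumes "definable_term F"
  shows "definable (\<lambda>e. ordinal (F e))"
  by (rule definable_comp1[OF _ assms]) (unfold ordinal_def, intro definable_intros)

lemma definable_limit_ordinal [definable_intros]:
  assumes "definable_term F"
  shows "definable (\<lambda>e. limit_ordinal (F e))"
  by (rule definable_comp1[OF _ assms]) (unfold limit_ordinal_def, intro definable_intros)

lemma mem_irrefl [simp]: "\<not> x \<^bold>\<in> x"
  using foundation[of "upair x x"] by auto

lemma mem_asym: "x \<^bold>\<in> y \<Longrightarrow> \<not> y \<^bold>\<in> x"
  using foundation[of "upair x y"] by auto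

lemma osucc_inject [simp]: "osucc x = osucc y \<longleftrightarrow> x = y"
proof
  assume "osucc x = osucc y"
  then have "x \<^bold>\<in> osucc y" "y \<^bold>\<in> osucc x" using mem_osucc by metis+
  then show "x = y" using mem_asym[of x y] by auto
qed simp

lemma ordinal_is_set: "ordinal \<alpha> \<Longrightarrow> is_set \<alpha>"
  unfolding ordinal_def transitive_set_def by blast

lemma ordinal_mem: "ordinal \<alpha> \<Longrightarrow> \<beta> \<^bold>\<in> \<alpha> \<Longrightarrow> ordinal \<beta>"
  unfolding ordinal_def transitive_set_def by blast

lemma ordinal_trans: "ordinal \<alpha> \<Longrightarrow> \<beta> \<^bold>\<in> \<alpha> \<Longrightarrow> \<gamma> \<^bold>\<in> \<beta> \<Longrightarrow> \<gamma> \<^bold>\<in> \<alpha>"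
  unfolding ordinal_def transitive_set_def by blast

lemma ordinal_nul [simp]: "ordinal nul"
  unfolding ordinal_def transitive_set_def by simp

lemma ordinal_osucc_iff [simp]: "ordinal (osucc \<alpha>) \<longleftrightarrow> ordinal \<alpha>"
proof
  assume \<alpha>: "ordinal \<alpha>"
  then have "transitive_set (osucc \<alpha>)" unfolding transitive_set_def using ordinal_trans by auto
  then show "ordinal (osucc \<alpha>)" using \<alpha> unfolding ordinal_def by auto
qed (simp add: ordinal_mem[of "osucc \<alpha>"])

lemma Union_set_osucc: "ordinal \<alpha> \<Longrightarrow> Union_set (osucc \<alpha>) = \<alpha>"
  by (rule set_ext) (auto simp: mem_Union_set is_set_Union_set ordinal_is_set intro: ordinal_trans)

lemma limit_ordinal_ordinal: "limit_ordinal \<gamma> \<Longrightarrow> ordinal \<gamma>"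
  and limit_ordinal_neq_nul: "limit_ordinal \<gamma> \<Longrightarrow> \<gamma> \<noteq> nul"
  unfolding limit_ordinal_def by blast+

lemma not_limit_ordinal_osucc [simp]: "\<not> limit_ordinal (osucc \<alpha>)"
  unfolding limit_ordinal_def using mem_osucc[of \<alpha> \<alpha>] mem_irrefl[of "osucc \<alpha>"] by blast

lemma ordinal_induct [consumes 2, case_names less]:
  assumes "definable (\<lambda>e. P (e 0))" "ordinal \<alpha>"
    and step: "\<And>\<alpha>. ordinal \<alpha> \<Longrightarrow> (\<And>\<beta>. \<beta> \<^bold>\<in> \<alpha> \<Longrightarrow> P \<beta>) \<Longrightarrow> P \<alpha>"
  shows "P \<alpha>"
proof (rule ccontr)
  assume "\<not> P \<alpha>"
  have "small (\<lambda>x. x \<^bold>\<in> osucc \<alpha> \<and> \<not> P x)"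
    using assms(1) by (intro small_separation small_mem definable_not)
  then obtain v where v: "\<And>x. x \<^bold>\<in> v \<longleftrightarrow> x \<^bold>\<in> osucc \<alpha> \<and> \<not> P x" by (rule smallE) blast
  then have "\<alpha> \<^bold>\<in> v" using \<open>\<not> P \<alpha>\<close> by simp
  then obtain \<beta> where \<beta>: "\<beta> \<^bold>\<in> v" "\<And>\<gamma>. \<gamma> \<^bold>\<in> \<beta> \<Longrightarrow> \<not> \<gamma> \<^bold>\<in> v" using foundation[of v] by blast
  have \<alpha>: "ordinal (osucc \<alpha>)" using assms(2) by simp
  have "\<beta> \<^bold>\<in> osucc \<alpha>" "\<not> P \<beta>" using \<beta>(1) v by auto
  moreover have "P \<gamma>" if "\<gamma> \<^bold>\<in> \<beta>" for \<gamma>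
    using \<beta>(2) v ordinal_trans[OF \<alpha> \<open>\<beta> \<^bold>\<in> osucc \<alpha>\<close>] that by blast
  ultimately show False using step ordinal_mem[OF \<alpha>] by blast
qed

lemma ordinal_linear:
  assumes "ordinal \<alpha>" "ordinal \<beta>"
  shows "\<alpha> \<^bold>\<in> \<beta> \<or> \<alpha> = \<beta> \<or> \<beta> \<^bold>\<in> \<alpha>"
proof -
  let ?comparable = "\<lambda>\<alpha> \<beta>. \<alpha> \<^bold>\<in> \<beta> \<or> \<alpha> = \<beta> \<or> \<beta> \<^bold>\<in> \<alpha>"
  have "definable (\<lambda>e. \<forall>\<beta>. ordinal \<beta> \<longrightarrow> ?comparable (e 0) \<beta>)" by (intro definable_intros)
  from this assms(1) have "\<forall>\<beta>. ordinal \<beta> \<longrightarrow> ?comparable \<alpha> \<beta>"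
  proof (induction rule: ordinal_induct)
    case (less \<alpha>)
    have "?comparable \<alpha> \<beta>" if "ordinal \<beta>" for \<beta>
    proof -
      have "definable (\<lambda>e. ?comparable \<alpha> (e 0))" by (intro definable_intros)
      from this that show ?thesis
      proof (induction rule: ordinal_induct)
        case \<beta>: (less \<beta>)
        have "\<alpha> = \<beta>" if incomparable: "\<not> \<alpha> \<^bold>\<in> \<beta>" "\<not> \<beta> \<^bold>\<in> \<alpha>"
        proof (rule set_ext)
          show "is_set \<alpha>" "is_set \<beta>" using less.hyps \<beta>.hyps by (auto intro: ordinal_is_set)
          show "\<gamma> \<^bold>\<in> \<alpha> \<longleftrightarrow> \<gamma> \<^bold>\<in> \<beta>" for \<gamma>
            using less.IH[of \<gamma>] \<beta>.IH[of \<gamma>] less.hyps \<beta>.hyps incomparable ordinal_mem ordinal_trans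
            by metis
        qed
        then show ?case by blast
      qed
    qed
    then show ?case by blast
  qed
  then show ?thesis using assms(2) by blast
qed

lemma osucc_mem_osucc:
  assumes "ordinal \<beta>" "\<alpha> \<^bold>\<in> \<beta>"
  shows "osucc \<alpha> \<^bold>\<in> osucc \<beta>"
proof -
  have "\<not> \<beta> \<^bold>\<in> osucc \<alpha>" using assms mem_asym by auto
  then show ?thesis using ordinal_linear[of "osucc \<alpha>" \<beta>] assms ordinal_mem[OF assms] by auto
qed

lemma ordinal_cases:
  assumes "ordinal \<alpha>" "\<alpha> \<noteq> nul"
  obtains (one) "\<alpha> = osucc nul"
  | (osucc) \<beta> where "\<alpha> = osucc \<beta>" "\<beta> \<noteq> nul" "ordinal \<beta>"
  | (limit) "limit_ordinal \<alpha>"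
proof (cases "limit_ordinal \<alpha>")
  case False
  then obtain \<beta> where \<beta>: "\<beta> \<^bold>\<in> \<alpha>" "\<not> osucc \<beta> \<^bold>\<in> \<alpha>" using assms unfolding limit_ordinal_def by blast
  then have "osucc \<beta> = \<alpha>" using osucc_mem_osucc[OF assms(1)] by auto
  then show thesis using that(1,2) ordinal_mem[OF assms(1) \<beta>(1)] by blast
qed (rule that(3))

section \<open>Transfinite recursion\<close>

locale ordinal_recursion =
  fixes D :: "'v::zfa \<Rightarrow> bool" and step :: "'v \<Rightarrow> 'v \<Rightarrow> 'v"
  assumes definable_domain: "definable (\<lambda>e. D (e 0))"
    and definable_step: "definable_term (\<lambda>e. step (e 0) (e 1))"
    and step_cong: "\<And>\<beta> f g. ordinal \<beta> \<Longrightarrow> D \<beta> \<Longrightarrow>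
      (\<And>\<delta>. \<delta> \<^bold>\<in> \<beta> \<Longrightarrow> D \<delta> \<Longrightarrow> value_at f \<delta> = value_at g \<delta>) \<Longrightarrow> step f \<beta> = step g \<beta>"
begin

definition approx :: "'v \<Rightarrow> 'v \<Rightarrow> bool" where
  "approx \<alpha> f \<longleftrightarrow> function_on (\<lambda>\<beta>. \<beta> \<^bold>\<in> \<alpha> \<and> D \<beta>) f \<and>
     (\<forall>\<beta>. \<beta> \<^bold>\<in> \<alpha> \<longrightarrow> D \<beta> \<longrightarrow> value_at f \<beta> = step f \<beta>)"

lemma definable_approx:
  assumes "definable_term F" "definable_term G"
  shows "definable (\<lambda>e. approx (F e) (G e))"
  by (rule definable_comp2[OF _ assms])
    (unfold approx_def function_on_def, intro definable_intros
      definable_comp1[OF definable_domain] definable_term_comp2[OF definable_step])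

lemma approx_agree:
  assumes f: "ordinal \<alpha>" "approx \<alpha> f" and g: "ordinal \<alpha>'" "approx \<alpha>' g"
    and \<beta>: "\<beta> \<^bold>\<in> \<alpha>" "\<beta> \<^bold>\<in> \<alpha>'" "D \<beta>"
  shows "value_at f \<beta> = value_at g \<beta>"
proof -
  have "definable (\<lambda>e. e 0 \<^bold>\<in> \<alpha> \<and> e 0 \<^bold>\<in> \<alpha>' \<and> D (e 0) \<longrightarrow> value_at f (e 0) = value_at g (e 0))"
    by (intro definable_intros definable_domain)
  from this ordinal_mem[OF f(1) \<beta>(1)]
  have "\<beta> \<^bold>\<in> \<alpha> \<and> \<beta> \<^bold>\<in> \<alpha>' \<and> D \<beta> \<longrightarrow> value_at f \<beta> = value_at g \<beta>"
  proof (induction rule: ordinal_induct)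
    case (less \<beta>)
    have "step f \<beta> = step g \<beta>" if "\<beta> \<^bold>\<in> \<alpha>" "\<beta> \<^bold>\<in> \<alpha>'" "D \<beta>"
      using less that ordinal_trans[OF f(1)] ordinal_trans[OF g(1)] by (intro step_cong) blast+
    then show ?case using f(2) g(2) unfolding approx_def by metis
  qed
  then show ?thesis using \<beta> by blast
qed

lemma approx_step_eq:
  assumes "ordinal \<alpha>" "approx \<alpha> f" "ordinal \<alpha>'" "approx \<alpha>' g"
    and "ordinal \<beta>" "D \<beta>" "\<And>\<delta>. \<delta> \<^bold>\<in> \<beta> \<Longrightarrow> \<delta> \<^bold>\<in> \<alpha> \<and> \<delta> \<^bold>\<in> \<alpha>'"
  shows "step f \<beta> = step g \<beta>"
  using assms approx_agree[OF assms(1-4)] by (intro step_cong) blast+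

lemma approx_unique:
  assumes "ordinal \<alpha>" "approx \<alpha> f" "approx \<alpha> g"
  shows "f = g"
proof (rule function_on_ext)
  show "function_on (\<lambda>\<beta>. \<beta> \<^bold>\<in> \<alpha> \<and> D \<beta>) f" "function_on (\<lambda>\<beta>. \<beta> \<^bold>\<in> \<alpha> \<and> D \<beta>) g"
    using assms(2,3) unfolding approx_def by blast+
qed (use approx_agree assms in blast)

lemma approx_glue:
  assumes \<alpha>: "ordinal \<alpha>" and f: "function_on (\<lambda>\<beta>. \<beta> \<^bold>\<in> \<alpha> \<and> D \<beta>) f"
    and pieces: "\<And>\<beta>. \<beta> \<^bold>\<in> \<alpha> \<Longrightarrow> D \<beta> \<Longrightarrow> \<exists>g. approx \<beta> g \<and> value_at f \<beta> = step g \<beta>"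
  shows "approx \<alpha> f"
proof -
  have "value_at f \<beta> = step f \<beta>" if \<beta>: "\<beta> \<^bold>\<in> \<alpha>" "D \<beta>" for \<beta>
  proof -
    obtain g where g: "approx \<beta> g" "value_at f \<beta> = step g \<beta>" using pieces \<beta> by blast
    have \<beta>_ordinal: "ordinal \<beta>" using ordinal_mem[OF \<alpha> \<beta>(1)] .
    have "value_at g \<delta> = value_at f \<delta>" if \<delta>: "\<delta> \<^bold>\<in> \<beta>" "D \<delta>" for \<delta>
    proof -
      have "\<delta> \<^bold>\<in> \<alpha>" using ordinal_trans[OF \<alpha> \<beta>(1) \<delta>(1)] .
      then obtain h where h: "approx \<delta> h" "value_at f \<delta> = step h \<delta>" using pieces \<delta>(2) by blast
      have \<delta>_ordinal: "ordinal \<delta>" using ordinal_mem[OF \<beta>_ordinal \<delta>(1)] .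
      have "value_at g \<delta> = step g \<delta>" using g(1) \<delta> unfolding approx_def by blast
      also have "\<dots> = step h \<delta>"
        using approx_step_eq[OF \<beta>_ordinal g(1) \<delta>_ordinal h(1) \<delta>_ordinal \<delta>(2)]
          ordinal_trans[OF \<beta>_ordinal \<delta>(1)] by blast
      finally show ?thesis using h(2) by simp
    qed
    then have "step g \<beta> = step f \<beta>" using \<beta>_ordinal \<beta>(2) by (intro step_cong) blast+
    then show ?thesis using g(2) by simp
  qed
  then show ?thesis using f unfolding approx_def by blast
qed

lemma approx_exists:
  assumes "ordinal \<alpha>"
  shows "\<exists>f. approx \<alpha> f"
proof -
  have "definable (\<lambda>e. \<exists>f. approx (e 0) f)" by (intro definable_intros definable_approx)
  from this assms show ?thesis
  proof (induction rule: ordinal_induct)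
    case (less \<alpha>)
    let ?A = "\<lambda>\<beta>. \<beta> \<^bold>\<in> \<alpha> \<and> D \<beta>" and ?P = "\<lambda>\<beta> m. \<exists>g. approx \<beta> g \<and> m = step g \<beta>"
    have "small ?A" by (intro small_separation small_mem definable_domain)
    moreover have "definable (\<lambda>e. ?P (e 0) (e 1))"
      by (intro definable_intros definable_approx definable_term_comp2[OF definable_step])
    moreover have "\<exists>!m. ?P \<beta> m" if "?A \<beta>" for \<beta>
      using less.IH approx_unique ordinal_mem[OF less.hyps] that by blast
    ultimately have "\<exists>f. function_on ?A f \<and> (\<forall>\<beta>. ?A \<beta> \<longrightarrow> ?P \<beta> (value_at f \<beta>))"
      by (rule function_on_exists)
    then show ?case using approx_glue[OF less.hyps] by blast
  qed
qed

definition rec_at :: "'v \<Rightarrow> 'v" where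
  "rec_at \<alpha> = (if ordinal \<alpha> then step (THE f. approx \<alpha> f) \<alpha> else nul)"

lemma rec_at_eq_step:
  assumes "ordinal \<alpha>" "approx \<alpha> f"
  shows "rec_at \<alpha> = step f \<alpha>"
proof -
  have "(THE f. approx \<alpha> f) = f" using assms approx_unique by blast
  then show ?thesis unfolding rec_at_def using assms(1) by simp
qed

lemma value_at_approx:
  assumes "ordinal \<alpha>" "approx \<alpha> f" "\<beta> \<^bold>\<in> \<alpha>" "D \<beta>"
  shows "value_at f \<beta> = rec_at \<beta>"
proof -
  have \<beta>: "ordinal \<beta>" using ordinal_mem[OF assms(1,3)] .
  then obtain g where g: "approx \<beta> g" using approx_exists by blast
  have "value_at f \<beta> = step f \<beta>" using assms unfolding approx_def by blast
  also have "\<dots> = step g \<beta>"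
    using approx_step_eq[OF assms(1,2) \<beta> g \<beta> assms(4)] ordinal_trans[OF assms(1,3)] by blast
  finally show ?thesis using rec_at_eq_step[OF \<beta> g] by simp
qed

lemma rec_at_unfold:
  assumes "ordinal \<alpha>"
  shows "\<exists>f. rec_at \<alpha> = step f \<alpha> \<and> (\<forall>\<beta>. \<beta> \<^bold>\<in> \<alpha> \<longrightarrow> D \<beta> \<longrightarrow> value_at f \<beta> = rec_at \<beta>)"
  using approx_exists[OF assms] rec_at_eq_step[OF assms] value_at_approx[OF assms] by blast

lemma rec_at_eq_iff:
  "v = rec_at \<alpha> \<longleftrightarrow> ordinal \<alpha> \<and> (\<exists>f. approx \<alpha> f \<and> v = step f \<alpha>) \<or> \<not> ordinal \<alpha> \<and> v = nul"
proof (cases "ordinal \<alpha>")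
  case True
  then show ?thesis using approx_exists rec_at_eq_step by metis
qed (simp add: rec_at_def)

lemma definable_term_rec_at:
  assumes "definable_term F"
  shows "definable_term (\<lambda>e. rec_at (F e))"
  by (rule definable_term_comp1[OF _ assms])
    (unfold definable_term_def rec_at_eq_iff, intro definable_intros definable_approx
      definable_term_comp2[OF definable_step])

end

section \<open>Ordinal addition\<close>

definition oadd_step :: "'v::zfa \<Rightarrow> 'v \<Rightarrow> 'v \<Rightarrow> 'v" where
  "oadd_step \<alpha> f n = the_set (\<lambda>z. z \<^bold>\<in> \<alpha> \<or> (\<exists>k. k \<^bold>\<in> n \<and> z = value_at f k))"

interpretation oadd_recursion: ordinal_recursion "\<lambda>_. True" "oadd_step \<alpha>" for \<alpha> :: "'v::zfa"
proof
  show "definable (\<lambda>e :: nat \<Rightarrow> 'v. True)"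
    using definable_eq[OF definable_term_const definable_term_const, of nul nul] by simp
  show "definable_term (\<lambda>e. oadd_step \<alpha> (e 0) (e 1))"
    unfolding oadd_step_def by (intro definable_intros)
  show "oadd_step \<alpha> f \<beta> = oadd_step \<alpha> g \<beta>" if "\<And>\<delta>. \<delta> \<^bold>\<in> \<beta> \<Longrightarrow> True \<Longrightarrow> value_at f \<delta> = value_at g \<delta>"
    for \<beta> f g
    unfolding oadd_step_def using that by metis
qed

definition oadd :: "'v::zfa \<Rightarrow> 'v \<Rightarrow> 'v" where
  "oadd \<alpha> = oadd_recursion.rec_at \<alpha>"

lemma definable_term_oadd [definable_intros]:
  "definable_term F \<Longrightarrow> definable_term (\<lambda>e. oadd \<alpha> (F e))"
  unfolding oadd_def by (rule oadd_recursion.definable_term_rec_at)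

lemma
  assumes "ordinal n"
  shows is_set_oadd: "is_set (oadd \<alpha> n)"
    and mem_oadd: "z \<^bold>\<in> oadd \<alpha> n \<longleftrightarrow> z \<^bold>\<in> \<alpha> \<or> (\<exists>k. k \<^bold>\<in> n \<and> z = oadd \<alpha> k)"
proof -
  obtain f where f: "oadd \<alpha> n = oadd_step \<alpha> f n" "\<And>k. k \<^bold>\<in> n \<Longrightarrow> value_at f k = oadd \<alpha> k"
    using oadd_recursion.rec_at_unfold[OF assms] unfolding oadd_def by blast
  have small: "small (\<lambda>z. z \<^bold>\<in> \<alpha> \<or> (\<exists>k. k \<^bold>\<in> n \<and> z = value_at f k))"
    by (intro small_disj small_image small_mem definable_intros)
  show "is_set (oadd \<alpha> n)"
    unfolding f(1) oadd_step_def by (rule is_set_the_set[OF small])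
  show "z \<^bold>\<in> oadd \<alpha> n \<longleftrightarrow> z \<^bold>\<in> \<alpha> \<or> (\<exists>k. k \<^bold>\<in> n \<and> z = oadd \<alpha> k)"
    unfolding f(1) oadd_step_def mem_the_set[OF small] using f(2) by auto
qed

lemma oadd_nul: "is_set \<alpha> \<Longrightarrow> oadd \<alpha> nul = \<alpha>"
  by (rule set_ext) (simp_all add: is_set_oadd mem_oadd)

lemma oadd_osucc: "ordinal n \<Longrightarrow> oadd \<alpha> (osucc n) = osucc (oadd \<alpha> n)"
  by (rule set_ext) (auto simp: is_set_oadd mem_oadd)

lemma ordinal_oadd:
  assumes "ordinal \<alpha>" "ordinal n"
  shows "ordinal (oadd \<alpha> n)"
proof -
  have "definable (\<lambda>e. ordinal (oadd \<alpha> (e 0)))" by (intro definable_intros)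
  from this assms(2) show ?thesis
  proof (induction rule: ordinal_induct)
    case (less n)
    have "transitive_set (oadd \<alpha> n)"
      unfolding transitive_set_def
    proof (intro conjI allI impI)
      fix \<beta> \<gamma> assume "\<beta> \<^bold>\<in> oadd \<alpha> n" "\<gamma> \<^bold>\<in> \<beta>"
      then consider (summand) "\<beta> \<^bold>\<in> \<alpha>" | (shift) k where "k \<^bold>\<in> n" "\<gamma> \<^bold>\<in> oadd \<alpha> k"
        unfolding mem_oadd[OF less.hyps] by blast
      then show "\<gamma> \<^bold>\<in> oadd \<alpha> n"
      proof cases
        case summand
        then show ?thesis
          using ordinal_trans[OF assms(1) _ \<open>\<gamma> \<^bold>\<in> \<beta>\<close>] unfolding mem_oadd[OF less.hyps] by blast
      next
        case (shift k)
        then show ?thesis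
          using mem_oadd[OF ordinal_mem[OF less.hyps \<open>k \<^bold>\<in> n\<close>]] ordinal_trans[OF less.hyps \<open>k \<^bold>\<in> n\<close>]
          unfolding mem_oadd[OF less.hyps] by blast
      qed
    qed (rule is_set_oadd[OF less.hyps])
    moreover have "transitive_set \<beta>" if "\<beta> \<^bold>\<in> oadd \<alpha> n" for \<beta>
      using that assms(1) less.IH unfolding mem_oadd[OF less.hyps] ordinal_def by blast
    ultimately show ?case unfolding ordinal_def by blast
  qed
qed

lemma infinity_osucc:
  obtains s :: "'v::zfa" where "nul \<^bold>\<in> s" "\<And>x. x \<^bold>\<in> s \<Longrightarrow> osucc x \<^bold>\<in> s"
proof -
  obtain s :: 'v where s: "nul \<^bold>\<in> s" "\<And>x. x \<^bold>\<in> s \<Longrightarrow> \<exists>y. y \<^bold>\<in> s \<and> (\<forall>z. z \<^bold>\<in> y \<longleftrightarrow> z \<^bold>\<in> x \<or> z = x)"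
    using infinity by blast
  have "osucc x \<^bold>\<in> s" if "x \<^bold>\<in> s" for x
  proof -
    obtain y where y: "y \<^bold>\<in> s" "\<And>z. z \<^bold>\<in> y \<longleftrightarrow> z \<^bold>\<in> x \<or> z = x" using s(2)[OF \<open>x \<^bold>\<in> s\<close>] by blast
    then have "y = osucc x" by (intro set_ext) (auto intro: is_setI)
    then show ?thesis using y(1) by simp
  qed
  then show thesis using that s(1) by blast
qed

lemma limit_ordinal_above:
  fixes \<alpha> :: "'v::zfa"
  assumes "ordinal \<alpha>"
  obtains \<gamma> where "limit_ordinal \<gamma>" "\<alpha> \<^bold>\<in> \<gamma>"
proof -
  obtain s :: 'v where s: "nul \<^bold>\<in> s" "\<And>n. n \<^bold>\<in> s \<Longrightarrow> osucc n \<^bold>\<in> s" using infinity_osucc by blast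
  have "small (\<lambda>\<beta>. \<exists>n. (n \<^bold>\<in> s \<and> ordinal n) \<and> \<beta> \<^bold>\<in> oadd \<alpha> n)"
    by (intro small_UN small_separation small_mem definable_intros)
  then obtain \<gamma> where \<gamma>: "is_set \<gamma>" "\<And>\<beta>. \<beta> \<^bold>\<in> \<gamma> \<longleftrightarrow> (\<exists>n. (n \<^bold>\<in> s \<and> ordinal n) \<and> \<beta> \<^bold>\<in> oadd \<alpha> n)"
    by (rule smallE) blast
  have mem_ordinal: "ordinal \<beta>" if "\<beta> \<^bold>\<in> \<gamma>" for \<beta>
    using that ordinal_oadd[OF assms] ordinal_mem unfolding \<gamma>(2) by blast
  have "transitive_set \<gamma>"
    unfolding transitive_set_def \<gamma>(2) using \<gamma>(1) ordinal_oadd[OF assms] ordinal_trans by blast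
  then have "ordinal \<gamma>" using mem_ordinal unfolding ordinal_def by blast
  moreover have "osucc \<beta> \<^bold>\<in> \<gamma>" if "\<beta> \<^bold>\<in> \<gamma>" for \<beta>
  proof -
    obtain n where n: "n \<^bold>\<in> s" "ordinal n" "\<beta> \<^bold>\<in> oadd \<alpha> n" using \<open>\<beta> \<^bold>\<in> \<gamma>\<close> unfolding \<gamma>(2) by blast
    then have "osucc \<beta> \<^bold>\<in> oadd \<alpha> (osucc n)"
      using osucc_mem_osucc ordinal_oadd[OF assms] oadd_osucc by metis
    then show ?thesis unfolding \<gamma>(2) using s(2) n(1,2) ordinal_osucc_iff by blast
  qed
  moreover have "\<alpha> \<^bold>\<in> \<gamma>"
  proof -
    have "\<alpha> \<^bold>\<in> oadd \<alpha> (osucc nul)"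
      using assms by (simp add: oadd_osucc oadd_nul ordinal_is_set)
    then show ?thesis unfolding \<gamma>(2) using s ordinal_nul ordinal_osucc_iff by blast
  qed
  ultimately show thesis using that unfolding limit_ordinal_def by fastforce
qed

lemma limit_ordinal_above_both:
  assumes "ordinal \<alpha>" "ordinal \<beta>"
  obtains \<gamma> where "limit_ordinal \<gamma>" "\<alpha> \<^bold>\<in> \<gamma>" "\<beta> \<^bold>\<in> \<gamma>"
proof -
  obtain \<mu> where \<mu>: "ordinal \<mu>" "\<alpha> \<^bold>\<in> osucc \<mu>" "\<beta> \<^bold>\<in> osucc \<mu>"
    using assms ordinal_linear[OF assms] mem_osucc by metis
  obtain \<gamma> where \<gamma>: "limit_ordinal \<gamma>" "\<mu> \<^bold>\<in> \<gamma>" using \<mu>(1) by (rule limit_ordinal_above)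
  then have "osucc \<mu> \<^bold>\<in> \<gamma>" unfolding limit_ordinal_def by blast
  then have "\<alpha> \<^bold>\<in> \<gamma>" "\<beta> \<^bold>\<in> \<gamma>" using \<mu> ordinal_trans[OF limit_ordinal_ordinal[OF \<gamma>(1)]] by blast+
  then show thesis using that \<gamma>(1) by blast
qed

section \<open>The magmatic hierarchy\<close>

lemma definable_atom_le [definable_intros]:
  assumes "definable_term F" "definable_term G"
  shows "definable (\<lambda>e. atom_le R (F e) (G e))"
  using assms unfolding atom_le_def by (intro definable_intros)

lemma definable_term_magma_next [definable_intros]:
  assumes "definable_term F"
  shows "definable_term (\<lambda>e. magma_next (F e))"
  by (rule definable_term_comp1[OF _ assms]) (unfold magma_next_def, intro definable_intros)

definition magma_step :: "'v::zfa \<Rightarrow> 'v \<Rightarrow> 'v \<Rightarrow> 'v" where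
  "magma_step R f \<beta> =
     (if \<beta> = osucc nul then magma_base R
      else if limit_ordinal \<beta> then the_set (\<lambda>x. \<exists>\<delta>. \<delta> \<^bold>\<in> \<beta> \<and> \<delta> \<noteq> nul \<and> x \<^bold>\<in> value_at f \<delta>)
      else magma_next (value_at f (Union_set \<beta>)))"

lemma magma_step_one: "magma_step R f (osucc nul) = magma_base R"
  unfolding magma_step_def by simp

lemma magma_step_osucc:
  assumes "ordinal \<beta>" "\<beta> \<noteq> nul"
  shows "magma_step R f (osucc \<beta>) = magma_next (value_at f \<beta>)"
  using assms unfolding magma_step_def by (simp add: Union_set_osucc)

lemma magma_step_limit:
  assumes "limit_ordinal \<gamma>"
  shows "magma_step R f \<gamma> = the_set (\<lambda>x. \<exists>\<delta>. \<delta> \<^bold>\<in> \<gamma> \<and> \<delta> \<noteq> nul \<and> x \<^bold>\<in> value_at f \<delta>)"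
proof -
  have "\<gamma> \<noteq> osucc nul" using assms by auto
  then show ?thesis using assms unfolding magma_step_def by simp
qed

interpretation magma_recursion: ordinal_recursion "\<lambda>\<beta>. \<beta> \<noteq> nul" "magma_step R" for R :: "'v::zfa"
proof
  show "definable (\<lambda>e :: nat \<Rightarrow> 'v. e 0 \<noteq> nul)" by (intro definable_intros)
  show "definable_term (\<lambda>e. magma_step R (e 0) (e 1))"
    unfolding magma_step_def by (intro definable_intros)
  fix \<beta> f g :: 'v
  assume \<beta>: "ordinal \<beta>" "\<beta> \<noteq> nul"
    and eq: "\<And>\<delta>. \<delta> \<^bold>\<in> \<beta> \<Longrightarrow> \<delta> \<noteq> nul \<Longrightarrow> value_at f \<delta> = value_at g \<delta>"
  from \<beta> show "magma_step R f \<beta> = magma_step R g \<beta>"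
  proof (cases rule: ordinal_cases)
    case one
    then show ?thesis by (simp add: magma_step_one)
  next
    case (osucc \<gamma>)
    then show ?thesis using eq[of \<gamma>] by (simp add: magma_step_osucc)
  next
    case limit
    have "(\<exists>\<delta>. \<delta> \<^bold>\<in> \<beta> \<and> \<delta> \<noteq> nul \<and> x \<^bold>\<in> value_at f \<delta>) \<longleftrightarrow>
        (\<exists>\<delta>. \<delta> \<^bold>\<in> \<beta> \<and> \<delta> \<noteq> nul \<and> x \<^bold>\<in> value_at g \<delta>)" for x
      using eq by metis
    then show ?thesis by (simp add: magma_step_limit[OF limit])
  qed
qed

lemma magma_seq_iff_value_at:
  assumes "ordinal \<alpha>"
  shows "magma_seq R \<alpha> f \<longleftrightarrow> function_on (\<lambda>\<beta>. \<beta> \<^bold>\<in> osucc \<alpha> \<and> \<beta> \<noteq> nul) f \<and>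
     (osucc nul \<^bold>\<in> osucc \<alpha> \<longrightarrow> value_at f (osucc nul) = magma_base R) \<and>
     (\<forall>\<beta>. \<beta> \<noteq> nul \<and> osucc \<beta> \<^bold>\<in> osucc \<alpha> \<longrightarrow> value_at f (osucc \<beta>) = magma_next (value_at f \<beta>)) \<and>
     (\<forall>\<gamma>. limit_ordinal \<gamma> \<and> \<gamma> \<^bold>\<in> osucc \<alpha> \<longrightarrow>
        value_at f \<gamma> = the_set (\<lambda>x. \<exists>\<beta>. \<beta> \<^bold>\<in> \<gamma> \<and> \<beta> \<noteq> nul \<and> x \<^bold>\<in> value_at f \<beta>))"
    (is "_ \<longleftrightarrow> ?fun \<and> ?base \<and> ?succ \<and> ?limit")
proof -
  have \<alpha>: "ordinal (osucc \<alpha>)" using assms by simp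
  have app: "app f \<beta> = value_at f \<beta>" if ?fun "\<beta> \<^bold>\<in> osucc \<alpha>" "\<beta> \<noteq> nul" for \<beta>
    using app_eq_value_at[OF that(1)] that(2,3) by blast
  have below: "\<beta> \<^bold>\<in> osucc \<alpha>" if "osucc \<beta> \<^bold>\<in> osucc \<alpha>" for \<beta>
    using ordinal_trans[OF \<alpha> that] by simp
  have union: "(\<lambda>x. \<exists>\<beta>. \<beta> \<^bold>\<in> \<gamma> \<and> \<beta> \<noteq> nul \<and> x \<^bold>\<in> app f \<beta>) =
      (\<lambda>x. \<exists>\<beta>. \<beta> \<^bold>\<in> \<gamma> \<and> \<beta> \<noteq> nul \<and> x \<^bold>\<in> value_at f \<beta>)" if ?fun "\<gamma> \<^bold>\<in> osucc \<alpha>" for \<gamma>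
    using app[OF that(1)] ordinal_trans[OF \<alpha> that(2)] by metis
  have "magma_seq R \<alpha> f \<longleftrightarrow> ?fun \<and>
     (osucc nul \<^bold>\<in> osucc \<alpha> \<longrightarrow> app f (osucc nul) = magma_base R) \<and>
     (\<forall>\<beta>. \<beta> \<noteq> nul \<and> osucc \<beta> \<^bold>\<in> osucc \<alpha> \<longrightarrow> app f (osucc \<beta>) = magma_next (app f \<beta>)) \<and>
     (\<forall>\<gamma>. limit_ordinal \<gamma> \<and> \<gamma> \<^bold>\<in> osucc \<alpha> \<longrightarrow>
        app f \<gamma> = the_set (\<lambda>x. \<exists>\<beta>. \<beta> \<^bold>\<in> \<gamma> \<and> \<beta> \<noteq> nul \<and> x \<^bold>\<in> app f \<beta>))"
    unfolding magma_seq_def function_on_def by (simp only: conj_assoc)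
  also have "\<dots> \<longleftrightarrow> ?fun \<and> ?base \<and> ?succ \<and> ?limit"
    by (simp add: app below union limit_ordinal_neq_nul cong: conj_cong imp_cong del: mem_osucc)
  finally show ?thesis .
qed

lemma magma_seq_imp_approx:
  assumes \<alpha>: "ordinal \<alpha>" and seq: "magma_seq R \<alpha> f"
  shows "magma_recursion.approx R (osucc \<alpha>) f"
proof -
  have "value_at f \<beta> = magma_step R f \<beta>" if \<beta>: "\<beta> \<^bold>\<in> osucc \<alpha>" "\<beta> \<noteq> nul" for \<beta>
  proof -
    have "ordinal \<beta>" using ordinal_mem[OF _ \<beta>(1)] \<alpha> by simp
    then show ?thesis
      using \<beta>(2)
    proof (cases rule: ordinal_cases)
      case one
      then show ?thesis
        using seq \<beta> unfolding magma_seq_iff_value_at[OF \<alpha>]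
        by (simp add: magma_step_one del: mem_osucc)
    next
      case (osucc \<gamma>)
      then show ?thesis
        using seq \<beta> unfolding magma_seq_iff_value_at[OF \<alpha>]
        by (simp add: magma_step_osucc del: mem_osucc)
    next
      case limit
      then show ?thesis
        using seq \<beta> unfolding magma_seq_iff_value_at[OF \<alpha>]
        by (simp add: magma_step_limit del: mem_osucc)
    qed
  qed
  then show ?thesis
    using seq unfolding magma_recursion.approx_def magma_seq_iff_value_at[OF \<alpha>] by blast
qed

lemma approx_imp_magma_seq:
  assumes \<alpha>: "ordinal \<alpha>" and approx: "magma_recursion.approx R (osucc \<alpha>) f"
  shows "magma_seq R \<alpha> f"
  unfolding magma_seq_iff_value_at[OF \<alpha>]
proof (intro conjI allI impI)
  have step: "value_at f \<beta> = magma_step R f \<beta>" if "\<beta> \<^bold>\<in> osucc \<alpha>" "\<beta> \<noteq> nul" for \<beta>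
    using approx that unfolding magma_recursion.approx_def by blast
  show "function_on (\<lambda>\<beta>. \<beta> \<^bold>\<in> osucc \<alpha> \<and> \<beta> \<noteq> nul) f"
    using approx unfolding magma_recursion.approx_def by blast
  show "value_at f (osucc nul) = magma_base R" if "osucc nul \<^bold>\<in> osucc \<alpha>"
    using step[OF that] by (simp add: magma_step_one)
  show "value_at f (osucc \<beta>) = magma_next (value_at f \<beta>)"
    if \<beta>: "\<beta> \<noteq> nul \<and> osucc \<beta> \<^bold>\<in> osucc \<alpha>" for \<beta>
  proof -
    have "ordinal \<beta>" using ordinal_mem[of "osucc \<alpha>" "osucc \<beta>"] \<alpha> \<beta> by simp
    then show ?thesis using step[of "osucc \<beta>"] \<beta> by (simp add: magma_step_osucc del: mem_osucc)
  qed
  show "value_at f \<gamma> = the_set (\<lambda>x. \<exists>\<beta>. \<beta> \<^bold>\<in> \<gamma> \<and> \<beta> \<noteq> nul \<and> x \<^bold>\<in> value_at f \<beta>)"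
    if "limit_ordinal \<gamma> \<and> \<gamma> \<^bold>\<in> osucc \<alpha>" for \<gamma>
    using that step[of \<gamma>] limit_ordinal_neq_nul[of \<gamma>]
    by (simp add: magma_step_limit del: mem_osucc)
qed

lemma magma_level_eq_rec_at:
  assumes "ordinal \<alpha>" "\<alpha> \<noteq> nul"
  shows "magma_level R \<alpha> = magma_recursion.rec_at R \<alpha>"
proof -
  have \<alpha>: "ordinal (osucc \<alpha>)" using assms(1) by simp
  obtain f where f: "magma_recursion.approx R (osucc \<alpha>) f"
    using magma_recursion.approx_exists[OF \<alpha>] by blast
  have "(THE f. magma_seq R \<alpha> f) = f"
    using f magma_seq_imp_approx[OF assms(1)] approx_imp_magma_seq[OF assms(1)]
      magma_recursion.approx_unique[OF \<alpha>] by blast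
  moreover have "function_on (\<lambda>\<beta>. \<beta> \<^bold>\<in> osucc \<alpha> \<and> \<beta> \<noteq> nul) f"
    using f unfolding magma_recursion.approx_def by blast
  then have "app f \<alpha> = value_at f \<alpha>" using app_eq_value_at assms(2) by fastforce
  moreover have "value_at f \<alpha> = magma_recursion.rec_at R \<alpha>"
    using magma_recursion.value_at_approx[OF \<alpha> f] assms(2) by simp
  ultimately show ?thesis unfolding magma_level_def by simp
qed

lemma magma_level_unfold:
  assumes "ordinal \<alpha>" "\<alpha> \<noteq> nul"
  shows "\<exists>f. magma_level R \<alpha> = magma_step R f \<alpha> \<and>
    (\<forall>\<beta>. \<beta> \<^bold>\<in> \<alpha> \<longrightarrow> \<beta> \<noteq> nul \<longrightarrow> value_at f \<beta> = magma_level R \<beta>)"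
  using magma_recursion.rec_at_unfold[OF assms(1), of R] ordinal_mem[OF assms(1)] assms
  by (metis magma_level_eq_rec_at)

lemma magma_level_one: "magma_level R (osucc nul) = magma_base R"
  using magma_level_unfold[of "osucc nul" R] by (auto simp: magma_step_one)

lemma magma_level_osucc:
  assumes "ordinal \<alpha>" "\<alpha> \<noteq> nul"
  shows "magma_level R (osucc \<alpha>) = magma_next (magma_level R \<alpha>)"
  using magma_level_unfold[of "osucc \<alpha>" R] assms by (auto simp: magma_step_osucc)

lemma magma_level_limit:
  assumes "limit_ordinal \<gamma>"
  shows "magma_level R \<gamma> = the_set (\<lambda>x. \<exists>\<delta>. \<delta> \<^bold>\<in> \<gamma> \<and> \<delta> \<noteq> nul \<and> x \<^bold>\<in> magma_level R \<delta>)"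
proof -
  obtain f where f: "magma_level R \<gamma> = magma_step R f \<gamma>"
    "\<And>\<delta>. \<delta> \<^bold>\<in> \<gamma> \<Longrightarrow> \<delta> \<noteq> nul \<Longrightarrow> value_at f \<delta> = magma_level R \<delta>"
    using magma_level_unfold limit_ordinal_ordinal[OF assms] limit_ordinal_neq_nul[OF assms]
    by metis
  have "(\<exists>\<delta>. \<delta> \<^bold>\<in> \<gamma> \<and> \<delta> \<noteq> nul \<and> x \<^bold>\<in> value_at f \<delta>) \<longleftrightarrow>
      (\<exists>\<delta>. \<delta> \<^bold>\<in> \<gamma> \<and> \<delta> \<noteq> nul \<and> x \<^bold>\<in> magma_level R \<delta>)" for x
    using f(2) by auto
  then show ?thesis using f(1) by (simp add: magma_step_limit[OF assms])
qed

definition in_level :: "'v::zfa \<Rightarrow> 'v \<Rightarrow> 'v \<Rightarrow> bool" where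
  "in_level R \<alpha> x \<longleftrightarrow> ordinal \<alpha> \<and> \<alpha> \<noteq> nul \<and> x \<^bold>\<in> magma_level R \<alpha>"

lemma in_level_iff_rec_at:
  "in_level R \<alpha> x \<longleftrightarrow> ordinal \<alpha> \<and> \<alpha> \<noteq> nul \<and> x \<^bold>\<in> magma_recursion.rec_at R \<alpha>"
  unfolding in_level_def using magma_level_eq_rec_at by metis

lemma definable_in_level [definable_intros]:
  assumes "definable_term F" "definable_term G"
  shows "definable (\<lambda>e. in_level R (F e) (G e))"
  using assms unfolding in_level_iff_rec_at
  by (intro definable_intros magma_recursion.definable_term_rec_at)

lemma magmas_iff: "x \<in> magmas R \<longleftrightarrow> (\<exists>\<alpha>. in_level R \<alpha> x)"
  unfolding magmas_def in_level_def by simp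

lemma definable_magmas [definable_intros]:
  assumes "definable_term F"
  shows "definable (\<lambda>e. F e \<in> magmas R)"
  by (rule definable_comp1[OF _ assms]) (unfold magmas_iff, intro definable_intros)

lemma in_level_ordinal: "in_level R \<alpha> x \<Longrightarrow> ordinal \<alpha>"
  unfolding in_level_def by blast

lemma in_level_magmas: "in_level R \<alpha> x \<Longrightarrow> x \<in> magmas R"
  unfolding magmas_iff by blast

lemma small_magma_base:
  "small (\<lambda>x. x \<^bold>\<subseteq> atoms \<and> x \<noteq> nul \<and>
     (\<forall>a b. a \<^bold>\<in> x \<longrightarrow> b \<^bold>\<in> atoms \<longrightarrow> atom_le R b a \<longrightarrow> b \<^bold>\<in> x))"
  by (intro small_subset_separation definable_intros)

lemma small_magma_next:
  "small (\<lambda>x. x \<^bold>\<subseteq> m \<and> x \<noteq> nul \<and> (\<forall>y z. y \<^bold>\<in> x \<longrightarrow> z \<^bold>\<in> m \<longrightarrow> z \<^bold>\<subseteq> y \<longrightarrow> z \<^bold>\<in> x))"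
  by (intro small_subset_separation definable_intros)

lemma small_magma_limit:
  assumes "limit_ordinal \<gamma>"
  shows "small (\<lambda>x. \<exists>\<delta>. \<delta> \<^bold>\<in> \<gamma> \<and> \<delta> \<noteq> nul \<and> x \<^bold>\<in> magma_level R \<delta>)"
proof -
  have "small (\<lambda>x. \<exists>\<delta>. (\<delta> \<^bold>\<in> \<gamma> \<and> \<delta> \<noteq> nul) \<and> x \<^bold>\<in> magma_recursion.rec_at R \<delta>)"
    by (intro small_UN small_separation small_mem definable_intros
        magma_recursion.definable_term_rec_at)
  moreover have "(\<exists>\<delta>. (\<delta> \<^bold>\<in> \<gamma> \<and> \<delta> \<noteq> nul) \<and> x \<^bold>\<in> magma_recursion.rec_at R \<delta>) \<longleftrightarrow>
      (\<exists>\<delta>. \<delta> \<^bold>\<in> \<gamma> \<and> \<delta> \<noteq> nul \<and> x \<^bold>\<in> magma_level R \<delta>)" for x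
    using magma_level_eq_rec_at ordinal_mem[OF limit_ordinal_ordinal[OF assms]] by metis
  ultimately show ?thesis by simp
qed

lemma is_set_magma_level:
  assumes "ordinal \<alpha>" "\<alpha> \<noteq> nul"
  shows "is_set (magma_level R \<alpha>)"
  using assms
proof (cases rule: ordinal_cases)
  case one
  show ?thesis
    unfolding one magma_level_one magma_base_def by (rule is_set_the_set[OF small_magma_base])
next
  case (osucc \<beta>)
  show ?thesis
    unfolding osucc(1) magma_level_osucc[OF osucc(3,2)] magma_next_def
    by (rule is_set_the_set[OF small_magma_next])
next
  case limit
  show ?thesis
    unfolding magma_level_limit[OF limit] by (rule is_set_the_set[OF small_magma_limit[OF limit]])
qed

lemma in_level_one:
  "in_level R (osucc nul) x \<longleftrightarrow> x \<^bold>\<subseteq> atoms \<and> x \<noteq> nul \<and>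
     (\<forall>a b. a \<^bold>\<in> x \<longrightarrow> b \<^bold>\<in> atoms \<longrightarrow> atom_le R b a \<longrightarrow> b \<^bold>\<in> x)"
  unfolding in_level_def magma_level_one magma_base_def mem_the_set[OF small_magma_base] by simp

lemma in_level_osucc:
  assumes "ordinal \<alpha>" "\<alpha> \<noteq> nul"
  shows "in_level R (osucc \<alpha>) x \<longleftrightarrow> is_set x \<and> x \<noteq> nul \<and> (\<forall>y. y \<^bold>\<in> x \<longrightarrow> in_level R \<alpha> y) \<and>
     (\<forall>y z. y \<^bold>\<in> x \<longrightarrow> in_level R \<alpha> z \<longrightarrow> z \<^bold>\<subseteq> y \<longrightarrow> z \<^bold>\<in> x)"
  unfolding in_level_def magma_level_osucc[OF assms] magma_next_def
    mem_the_set[OF small_magma_next] subset_of_def[of x]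
  using assms is_set_magma_level[OF assms] by (simp add: conj_ac)

lemma in_level_limit:
  assumes "limit_ordinal \<gamma>"
  shows "in_level R \<gamma> x \<longleftrightarrow> (\<exists>\<delta>. \<delta> \<^bold>\<in> \<gamma> \<and> in_level R \<delta> x)"
  unfolding in_level_def magma_level_limit[OF assms] mem_the_set[OF small_magma_limit[OF assms]]
  using limit_ordinal_ordinal[OF assms] limit_ordinal_neq_nul[OF assms] ordinal_mem by blast

text \<open>The hierarchy is not cumulative (\<open>M\<^sub>1\<close> and \<open>M\<^sub>2\<close> are disjoint), so that level \<open>\<beta>\<close> is
  contained in level \<open>\<alpha>\<close> is part of the claim.\<close>

lemma in_level_nonlimit:
  assumes "in_level R \<alpha> x"
  shows "\<exists>\<beta>. \<beta> \<^bold>\<in> osucc \<alpha> \<and> \<not> limit_ordinal \<beta> \<and> in_level R \<beta> x \<and>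
    (\<forall>y. in_level R \<beta> y \<longrightarrow> in_level R \<alpha> y)"
proof -
  let ?P = "\<lambda>\<alpha>. \<forall>x. in_level R \<alpha> x \<longrightarrow> (\<exists>\<beta>. \<beta> \<^bold>\<in> osucc \<alpha> \<and> \<not> limit_ordinal \<beta> \<and>
      in_level R \<beta> x \<and> (\<forall>y. in_level R \<beta> y \<longrightarrow> in_level R \<alpha> y))"
  have "definable (\<lambda>e. ?P (e 0))" by (intro definable_intros)
  from this in_level_ordinal[OF assms] have "?P \<alpha>"
  proof (induction rule: ordinal_induct)
    case (less \<alpha>)
    show ?case
    proof (cases "limit_ordinal \<alpha>")
      case limit: True
      show ?thesis
      proof (intro allI impI)
        fix x assume "in_level R \<alpha> x"
        then obtain \<gamma> where \<gamma>: "\<gamma> \<^bold>\<in> \<alpha>" "in_level R \<gamma> x" unfolding in_level_limit[OF limit] by blast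
        then obtain \<beta> where \<beta>: "\<beta> \<^bold>\<in> osucc \<gamma>" "\<not> limit_ordinal \<beta>" "in_level R \<beta> x"
          "\<forall>y. in_level R \<beta> y \<longrightarrow> in_level R \<gamma> y"
          using less.IH by blast
        have "\<beta> \<^bold>\<in> osucc \<alpha>" using \<beta>(1) \<gamma>(1) ordinal_trans[OF less.hyps] by auto
        then show "\<exists>\<beta>. \<beta> \<^bold>\<in> osucc \<alpha> \<and> \<not> limit_ordinal \<beta> \<and> in_level R \<beta> x \<and>
            (\<forall>y. in_level R \<beta> y \<longrightarrow> in_level R \<alpha> y)"
          using \<beta>(2-) \<gamma>(1) unfolding in_level_limit[OF limit] by blast
      qed
    next
      case False
      then show ?thesis by auto
    qed
  qed
  then show ?thesis using assms by blast
qed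

lemma in_level_cases:
  assumes "in_level R \<alpha> x"
  obtains (one) "in_level R (osucc nul) x" "\<And>y. in_level R (osucc nul) y \<Longrightarrow> in_level R \<alpha> y"
  | (osucc) \<gamma> where "\<gamma> \<^bold>\<in> \<alpha>" "\<gamma> \<noteq> nul" "ordinal \<gamma>" "in_level R (osucc \<gamma>) x"
      "\<And>y. in_level R (osucc \<gamma>) y \<Longrightarrow> in_level R \<alpha> y"
proof -
  obtain \<beta> where \<beta>: "\<beta> \<^bold>\<in> osucc \<alpha>" "\<not> limit_ordinal \<beta>" "in_level R \<beta> x"
    and up: "\<And>y. in_level R \<beta> y \<Longrightarrow> in_level R \<alpha> y"
    using in_level_nonlimit[OF assms] by blast
  have "ordinal \<beta>" "\<beta> \<noteq> nul" using \<beta>(3) unfolding in_level_def by blast+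
  then show thesis
  proof (cases rule: ordinal_cases)
    case (osucc \<gamma>)
    have "\<gamma> \<^bold>\<in> \<alpha>" using \<beta>(1) ordinal_trans[OF in_level_ordinal[OF assms]] unfolding osucc(1) by auto
    then show thesis using that(2) osucc \<beta>(3) up by blast
  qed (use that(1) \<beta>(2,3) up in blast)+
qed

lemma magma_is_set: "x \<in> magmas R \<Longrightarrow> is_set x"
  and magma_neq_nul: "x \<in> magmas R \<Longrightarrow> x \<noteq> nul"
proof -
  have "is_set x \<and> x \<noteq> nul" if "x \<in> magmas R" for x
  proof -
    obtain \<alpha> where "in_level R \<alpha> x" using \<open>x \<in> magmas R\<close> unfolding magmas_iff by blast
    then show ?thesis
    proof (cases rule: in_level_cases)
      case one
      then show ?thesis unfolding in_level_one subset_of_def by blast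
    next
      case (osucc \<gamma>)
      then show ?thesis using in_level_osucc[OF osucc(3,2)] by blast
    qed
  qed
  then show "x \<in> magmas R \<Longrightarrow> is_set x" "x \<in> magmas R \<Longrightarrow> x \<noteq> nul" by auto
qed

lemma magma_not_atom: "x \<in> magmas R \<Longrightarrow> \<not> x \<^bold>\<in> atoms"
  using magma_is_set unfolding is_set_def by blast

lemma level_one_osucc_incomparable:
  assumes x: "in_level R (osucc nul) x" and y: "in_level R (osucc \<gamma>) y" "\<gamma> \<noteq> nul"
  shows "\<not> x \<^bold>\<subseteq> y" "\<not> y \<^bold>\<subseteq> x"
proof -
  have \<gamma>: "ordinal \<gamma>" using in_level_ordinal[OF y(1)] by simp
  have "z \<^bold>\<in> atoms" if "z \<^bold>\<in> x" for z
    using x that unfolding in_level_one subset_of_def by blast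
  moreover have "\<not> z \<^bold>\<in> atoms" if "z \<^bold>\<in> y" for z
    using y(1) that magma_not_atom[OF in_level_magmas] unfolding in_level_osucc[OF \<gamma> y(2)] by blast
  moreover obtain z where "z \<^bold>\<in> x"
    using in_level_magmas[OF x] magma_is_set magma_neq_nul nonempty_set by metis
  moreover obtain w where "w \<^bold>\<in> y"
    using in_level_magmas[OF y(1)] magma_is_set magma_neq_nul nonempty_set by metis
  ultimately show "\<not> x \<^bold>\<subseteq> y" "\<not> y \<^bold>\<subseteq> x" by (blast dest: subsetD)+
qed

definition level_subset_closed :: "'v::zfa \<Rightarrow> 'v \<Rightarrow> 'v \<Rightarrow> bool" where
  "level_subset_closed R \<alpha> \<beta> \<longleftrightarrow>
     (\<forall>x y. in_level R \<alpha> x \<longrightarrow> in_level R \<beta> y \<longrightarrow> y \<^bold>\<subseteq> x \<longrightarrow> in_level R \<alpha> y)"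

lemma definable_level_subset_closed [definable_intros]:
  assumes "definable_term F" "definable_term G"
  shows "definable (\<lambda>e. level_subset_closed R (F e) (G e))"
  by (rule definable_comp2[OF _ assms]) (unfold level_subset_closed_def, intro definable_intros)

text \<open>The hypothesis exchanges the roles of the two levels, which is why the induction on levels has
  to prove closure in both directions at once.\<close>

lemma level_subset_closed_osucc:
  assumes closed: "level_subset_closed R \<delta> \<gamma>"
    and \<gamma>: "ordinal \<gamma>" "\<gamma> \<noteq> nul" and \<delta>: "ordinal \<delta>" "\<delta> \<noteq> nul"
  shows "level_subset_closed R (osucc \<gamma>) (osucc \<delta>)"
  unfolding level_subset_closed_def
proof (intro allI impI)
  fix x y assume x: "in_level R (osucc \<gamma>) x" and y: "in_level R (osucc \<delta>) y" and "y \<^bold>\<subseteq> x"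
  note y_iff = y[unfolded in_level_osucc[OF \<delta>]]
  show "in_level R (osucc \<gamma>) y"
    unfolding in_level_osucc[OF \<gamma>]
  proof (intro conjI allI impI)
    show "is_set y" "y \<noteq> nul" using y_iff by blast+
    show "in_level R \<gamma> w" if "w \<^bold>\<in> y" for w
      using x subsetD[OF \<open>y \<^bold>\<subseteq> x\<close> that] unfolding in_level_osucc[OF \<gamma>] by blast
    show "z \<^bold>\<in> y" if "w \<^bold>\<in> y" "in_level R \<gamma> z" "z \<^bold>\<subseteq> w" for w z
    proof -
      have "in_level R \<delta> w" using y_iff \<open>w \<^bold>\<in> y\<close> by blast
      then have "in_level R \<delta> z" using closed that(2,3) unfolding level_subset_closed_def by blast
      then show ?thesis using y_iff that by blast
    qed
  qed
qed

lemma level_subset_closed_both: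
  assumes "ordinal \<alpha>"
  shows "\<forall>\<beta>. level_subset_closed R \<alpha> \<beta> \<and> level_subset_closed R \<beta> \<alpha>"
proof -
  have "definable (\<lambda>e. \<forall>\<beta>. level_subset_closed R (e 0) \<beta> \<and> level_subset_closed R \<beta> (e 0))"
    by (intro definable_intros)
  from this assms show ?thesis
  proof (induction rule: ordinal_induct)
    case (less \<alpha>)
    have "(y \<^bold>\<subseteq> x \<longrightarrow> in_level R \<alpha> y) \<and> (x \<^bold>\<subseteq> y \<longrightarrow> in_level R \<beta> x)"
      if x: "in_level R \<alpha> x" and y: "in_level R \<beta> y" for \<beta> x y
      using x
    proof (cases rule: in_level_cases)
      case \<alpha>_one: one
      from y show ?thesis
      proof (cases rule: in_level_cases)
        case (osucc \<delta>)
        then show ?thesis using level_one_osucc_incomparable \<alpha>_one(1) by blast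
      qed (use \<alpha>_one in blast)
    next
      case \<alpha>_osucc: (osucc \<gamma>)
      from y show ?thesis
      proof (cases rule: in_level_cases)
        case one
        then show ?thesis using level_one_osucc_incomparable \<alpha>_osucc(2,4) by blast
      next
        case (osucc \<delta>)
        have "level_subset_closed R (osucc \<gamma>) (osucc \<delta>)" "level_subset_closed R (osucc \<delta>) (osucc \<gamma>)"
          using less.IH[OF \<alpha>_osucc(1)] \<alpha>_osucc(2,3) osucc(2,3)
          by (simp_all add: level_subset_closed_osucc)
        then show ?thesis
          using \<alpha>_osucc(4,5) osucc(4,5) unfolding level_subset_closed_def by blast
      qed
    qed
    then show ?case unfolding level_subset_closed_def by blast
  qed
qed

lemma in_level_subset:
  assumes "in_level R \<alpha> x" "y \<in> magmas R" "y \<^bold>\<subseteq> x"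
  shows "in_level R \<alpha> y"
  using assms level_subset_closed_both[OF in_level_ordinal[OF assms(1)]]
  unfolding magmas_iff level_subset_closed_def by blast

lemma magmaI:
  assumes "ordinal \<gamma>" "\<gamma> \<noteq> nul" "is_set x" "x \<noteq> nul" "\<And>y. y \<^bold>\<in> x \<Longrightarrow> in_level R \<gamma> y"
    and "\<And>y z. y \<^bold>\<in> x \<Longrightarrow> z \<in> magmas R \<Longrightarrow> z \<^bold>\<subseteq> y \<Longrightarrow> z \<^bold>\<in> x"
  shows "x \<in> magmas R"
proof -
  have "in_level R (osucc \<gamma>) x"
    unfolding in_level_osucc[OF assms(1,2)] using assms(3-) in_level_magmas by blast
  then show ?thesis by (rule in_level_magmas)
qed

section \<open>Predecessor sets and the magmatic pair\<close>

lemma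
  assumes "is_set x"
  shows is_set_pr: "is_set (pr R x)"
    and mem_pr: "z \<^bold>\<in> pr R x \<longleftrightarrow> z \<in> magmas R \<and> z \<^bold>\<subseteq> x"
proof -
  have "small (\<lambda>z. z \<^bold>\<subseteq> x \<and> z \<in> magmas R)" by (intro small_subset_separation definable_intros)
  then have small: "small (\<lambda>z. z \<in> magmas R \<and> z \<^bold>\<subseteq> x)" by (simp only: conj_commute)
  have pr: "pr R x = the_set (\<lambda>y. y \<in> magmas R \<and> y \<^bold>\<subseteq> x)"
    using assms unfolding pr_def is_set_def by simp
  show "is_set (pr R x)" "z \<^bold>\<in> pr R x \<longleftrightarrow> z \<in> magmas R \<and> z \<^bold>\<subseteq> x"
    unfolding pr by (rule is_set_the_set[OF small] mem_the_set[OF small])+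
qed

lemma
  assumes "a \<^bold>\<in> atoms"
  shows is_set_pr_atom: "is_set (pr R a)"
    and mem_pr_atom: "z \<^bold>\<in> pr R a \<longleftrightarrow> z \<^bold>\<in> atoms \<and> atom_le R z a"
proof -
  have small: "small (\<lambda>z. z \<^bold>\<in> atoms \<and> atom_le R z a)"
    by (intro small_separation small_mem definable_intros)
  have pr: "pr R a = the_set (\<lambda>b. b \<^bold>\<in> atoms \<and> atom_le R b a)"
    using assms unfolding pr_def by simp
  show "is_set (pr R a)" "z \<^bold>\<in> pr R a \<longleftrightarrow> z \<^bold>\<in> atoms \<and> atom_le R z a"
    unfolding pr by (rule is_set_the_set[OF small] mem_the_set[OF small])+
qed

lemma mem_pr_magma: "x \<in> magmas R \<Longrightarrow> z \<^bold>\<in> pr R x \<longleftrightarrow> z \<in> magmas R \<and> z \<^bold>\<subseteq> x"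
  by (rule mem_pr[OF magma_is_set])

lemma mem_pr_self: "x \<in> magmas R \<Longrightarrow> x \<^bold>\<in> pr R x"
  by (simp add: mem_pr_magma subset_refl magma_is_set)

lemma pr_magma:
  assumes "x \<in> magmas R"
  shows "pr R x \<in> magmas R"
proof -
  obtain \<alpha> where \<alpha>: "in_level R \<alpha> x" using assms unfolding magmas_iff by blast
  show ?thesis
  proof (rule magmaI)
    show "ordinal \<alpha>" "\<alpha> \<noteq> nul" using \<alpha> unfolding in_level_def by blast+
    show "is_set (pr R x)" by (rule is_set_pr[OF magma_is_set[OF assms]])
    show "pr R x \<noteq> nul" using mem_pr_self[OF assms] by auto
    show "in_level R \<alpha> y" if "y \<^bold>\<in> pr R x" for y
      using that in_level_subset[OF \<alpha>] unfolding mem_pr_magma[OF assms] by blast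
    show "z \<^bold>\<in> pr R x" if "y \<^bold>\<in> pr R x" "z \<in> magmas R" "z \<^bold>\<subseteq> y" for y z
      using that subset_trans unfolding mem_pr_magma[OF assms] by blast
  qed
qed

lemma mem_pr_atom_self: "preorder_on_atoms R \<Longrightarrow> a \<^bold>\<in> atoms \<Longrightarrow> a \<^bold>\<in> pr R a"
  unfolding preorder_on_atoms_def by (simp add: mem_pr_atom)

lemma pr_atom_magma:
  assumes R: "preorder_on_atoms R" and a: "a \<^bold>\<in> atoms"
  shows "pr R a \<in> magmas R"
proof -
  have "atom_le R c a" if "atom_le R b a" "atom_le R c b" for b c
    using R that unfolding preorder_on_atoms_def by blast
  moreover have "pr R a \<^bold>\<subseteq> atoms"
    unfolding subset_of_def mem_pr_atom[OF a] using is_set_pr_atom[OF a] is_setI[OF a] by blast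
  moreover have "pr R a \<noteq> nul" using mem_pr_atom_self[OF R a] by auto
  ultimately have "in_level R (osucc nul) (pr R a)"
    unfolding in_level_one mem_pr_atom[OF a] by blast
  then show ?thesis by (rule in_level_magmas)
qed

lemma common_limit_level:
  assumes "x \<in> magmas R" "y \<in> magmas R"
  obtains \<gamma> where "limit_ordinal \<gamma>" "in_level R \<gamma> x" "in_level R \<gamma> y"
proof -
  obtain \<alpha> \<beta> where \<alpha>: "in_level R \<alpha> x" and \<beta>: "in_level R \<beta> y"
    using assms unfolding magmas_iff by blast
  obtain \<gamma> where \<gamma>: "limit_ordinal \<gamma>" "\<alpha> \<^bold>\<in> \<gamma>" "\<beta> \<^bold>\<in> \<gamma>"
    using in_level_ordinal[OF \<alpha>] in_level_ordinal[OF \<beta>] by (rule limit_ordinal_above_both)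
  have "in_level R \<gamma> x" "in_level R \<gamma> y"
    unfolding in_level_limit[OF \<gamma>(1)] using \<alpha> \<beta> \<gamma>(2,3) by blast+
  then show thesis by (rule that[OF \<gamma>(1)])
qed

lemma pr_un_pr_magma:
  assumes x: "x \<in> magmas R" and y: "y \<in> magmas R"
  shows "pr R x \<^bold>\<union> pr R y \<in> magmas R"
proof -
  obtain \<gamma> where \<gamma>: "limit_ordinal \<gamma>" "in_level R \<gamma> x" "in_level R \<gamma> y"
    using assms by (rule common_limit_level)
  show ?thesis
  proof (rule magmaI)
    show "ordinal \<gamma>" "\<gamma> \<noteq> nul"
      using limit_ordinal_ordinal[OF \<gamma>(1)] limit_ordinal_neq_nul[OF \<gamma>(1)] .
    show "is_set (pr R x \<^bold>\<union> pr R y)" by simp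
    show "pr R x \<^bold>\<union> pr R y \<noteq> nul" using mem_pr_self[OF x] mem_un not_mem_nul by metis
    show "in_level R \<gamma> z" if "z \<^bold>\<in> pr R x \<^bold>\<union> pr R y" for z
      using that in_level_subset[OF \<gamma>(2)] in_level_subset[OF \<gamma>(3)]
      unfolding mem_un mem_pr_magma[OF x] mem_pr_magma[OF y] by blast
    show "w \<^bold>\<in> pr R x \<^bold>\<union> pr R y" if "z \<^bold>\<in> pr R x \<^bold>\<union> pr R y" "w \<in> magmas R" "w \<^bold>\<subseteq> z" for z w
      using that subset_trans unfolding mem_un mem_pr_magma[OF x] mem_pr_magma[OF y] by blast
  qed
qed

definition pair_component :: "'v::zfa \<Rightarrow> 'v \<Rightarrow> 'v \<Rightarrow> 'v" where
  "pair_component R a x = pr R (pr R x) \<^bold>\<union> pr R (pr R a)"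

lemma magma_pair_eq_components:
  "magma_pair R a b x y = pr R (pair_component R a x) \<^bold>\<union> pr R (pair_component R b y)"
  unfolding magma_pair_def pair_component_def ..

lemma magma_pair_commute: "magma_pair R a b x y = magma_pair R b a y x"
  unfolding magma_pair_eq_components by (auto intro: set_ext)

context
  fixes R :: "'v::zfa"
  assumes R: "preorder_on_atoms R"
begin

lemma pair_component_magma:
  assumes "a \<^bold>\<in> atoms" "x \<in> magmas R"
  shows "pair_component R a x \<in> magmas R"
  unfolding pair_component_def
  by (rule pr_un_pr_magma[OF pr_magma[OF assms(2)] pr_atom_magma[OF R assms(1)]])

lemma mem_pair_component:
  assumes "a \<^bold>\<in> atoms" "x \<in> magmas R"
  shows "z \<^bold>\<in> pair_component R a x \<longleftrightarrow> z \<in> magmas R \<and> (z \<^bold>\<subseteq> pr R x \<or> z \<^bold>\<subseteq> pr R a)"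
  unfolding pair_component_def mem_un mem_pr_magma[OF pr_magma[OF assms(2)]]
    mem_pr_magma[OF pr_atom_magma[OF R assms(1)]] by blast

lemma pair_component_not_subset:
  assumes a: "a \<^bold>\<in> atoms" and b: "b \<^bold>\<in> atoms" and "\<not> atom_le R a b"
    and x: "x \<in> magmas R" and y: "y \<in> magmas R"
  shows "\<not> pair_component R a x \<^bold>\<subseteq> pair_component R b y"
proof
  assume "pair_component R a x \<^bold>\<subseteq> pair_component R b y"
  moreover have "pr R a \<^bold>\<in> pair_component R a x"
    unfolding mem_pair_component[OF a x]
    using pr_atom_magma[OF R a] subset_refl[OF is_set_pr_atom[OF a]] by blast
  ultimately have "pr R a \<^bold>\<subseteq> pr R y \<or> pr R a \<^bold>\<subseteq> pr R b"
    using subsetD mem_pair_component[OF b y] by blast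
  then have "a \<^bold>\<in> pr R y \<or> a \<^bold>\<in> pr R b" using mem_pr_atom_self[OF R a] subsetD by blast
  then show False
    using magma_not_atom a assms(3) unfolding mem_pr_magma[OF y] mem_pr_atom[OF b] by blast
qed

lemma pair_component_subsetD:
  assumes a: "a \<^bold>\<in> atoms" and x: "x \<in> magmas R" and y: "y \<in> magmas R"
    and "pair_component R a x \<^bold>\<subseteq> pair_component R a y"
  shows "x \<^bold>\<subseteq> y"
proof -
  have "pr R x \<^bold>\<in> pair_component R a x"
    unfolding mem_pair_component[OF a x]
    using pr_magma[OF x] subset_refl[OF magma_is_set[OF pr_magma[OF x]]] by blast
  then have "pr R x \<^bold>\<subseteq> pr R y \<or> pr R x \<^bold>\<subseteq> pr R a"
    using assms(4) subsetD mem_pair_component[OF a y] by blast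
  then have "x \<^bold>\<in> pr R y \<or> x \<^bold>\<in> pr R a" using mem_pr_self[OF x] subsetD by blast
  then show ?thesis
    using magma_not_atom[OF x] unfolding mem_pr_magma[OF y] mem_pr_atom[OF a] by blast
qed

lemma magma_pair_eq_imp_subset:
  assumes a: "a \<^bold>\<in> atoms" and b: "b \<^bold>\<in> atoms" and "\<not> atom_le R a b"
    and magmas: "x \<in> magmas R" "x' \<in> magmas R" "y' \<in> magmas R"
    and eq: "magma_pair R a b x y = magma_pair R a b x' y'"
  shows "x \<^bold>\<subseteq> x'"
proof -
  let ?U = "pair_component R a x"
  have "?U \<^bold>\<in> magma_pair R a b x y"
    unfolding magma_pair_eq_components
    using mem_pr_self[OF pair_component_magma[OF a magmas(1)]] by simp
  then have "?U \<^bold>\<subseteq> pair_component R a x' \<or> ?U \<^bold>\<subseteq> pair_component R b y'"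
    unfolding eq unfolding magma_pair_eq_components mem_un
      mem_pr_magma[OF pair_component_magma[OF a magmas(2)]]
      mem_pr_magma[OF pair_component_magma[OF b magmas(3)]]
    by blast
  then show ?thesis
    using pair_component_not_subset[OF a b assms(3) magmas(1,3)]
      pair_component_subsetD[OF a magmas(1,2)] by blast
qed

lemma magma_pair_eq_imp_eq:
  assumes "a \<^bold>\<in> atoms" "b \<^bold>\<in> atoms" "\<not> atom_le R a b"
    and "x \<in> magmas R" "y \<in> magmas R" "x' \<in> magmas R" "y' \<in> magmas R"
    and "magma_pair R a b x y = magma_pair R a b x' y'"
  shows "x = x'"
  using magma_pair_eq_imp_subset[OF assms(1-4,6,7,8)]
    magma_pair_eq_imp_subset[OF assms(1-3,6,4,5) assms(8)[symmetric]]
  by (rule subset_antisym)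

end

theorem theorem3p4:
  fixes R a0 a1 x y x' y' :: "'v::zfa"
  assumes "preorder_on_atoms R"
    and "no_minimal_atoms R"
    and "a0 \<^bold>\<in> atoms" and "a1 \<^bold>\<in> atoms"
    and "\<not> atom_le R a0 a1" and "\<not> atom_le R a1 a0"
    and "x \<in> magmas R" and "y \<in> magmas R" and "x' \<in> magmas R" and "y' \<in> magmas R"
  shows "magma_pair R a0 a1 x y = magma_pair R a0 a1 x' y' \<longleftrightarrow> x = x' \<and> y = y'"
proof
  assume eq: "magma_pair R a0 a1 x y = magma_pair R a0 a1 x' y'"
  then have "x = x'"
    using magma_pair_eq_imp_eq[OF assms(1,3,4,5,7-10)] by blast
  moreover have "y = y'"
    using eq magma_pair_eq_imp_eq[OF assms(1,4,3,6,8,7,10,9)]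
    unfolding magma_pair_commute[of R a0 a1] by blast
  ultimately show "x = x' \<and> y = y'" ..
qed simp

end
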